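(* Let $B \ge 2$ be an integer and let $X = x_1, \dots, x_m$ be any sequence of searches over the keys $\{1,\dots,N\}$. Then $\mathrm{OPT}_{\mathrm{BST}}(X) = O(\mathrm{OPT}_{\mathrm{Btree}}(X) \cdot \log B)$, where $\mathrm{OPT}_{\mathrm{BST}}(X)$ and $\mathrm{OPT}_{\mathrm{Btree}}(X)$ denote the optimal offline costs of serving $X$ in the BST model and in the B-tree model with parameter $B$, respectively.
   Context: Keys are $\{1,\dots,N\}$; a search sequence is $X = x_1,\dots,x_m$ with each $x_i$ a key. BST model: the keys are stored in a binary search tree (one key per node, in-order condition). To serve search $x_i$, a single pointer is initialized at the root (unit cost), and then the algorithm performs unit-cost operations: move the pointer to the parent or to the left/right child of the current node, or rotate the edge between the current node and its parent. A node is touched when the pointer is at it; the search is correct if the node containing $x_i$ is touched. Nodes may store $O(\log N)$ extra bits. B-tree model with parameter $B\ge 2$: each node $v$ stores $n(v) \le B-1$ keys $x_1<\dots<x_{n(v)}$ and has $n(v)+1$ child pointers (possibly null), with the in-order condition (all keys in the $i$-th child subtree lie strictly between $x_{i-1}$ and $x_i$). To serve search $x_i$, a single pointer is initialized at the root (unit cost) and the algorithm performs unit-cost operations, and must touch the node containing $x_i$: (1) move the pointer to a child or the parent of the current node; (2) split a node $u$ with at least three keys at a key $u_m$ that is neither its smallest nor largest key, provided its parent is not full ($u_m$ is moved into the parent and $u$ is replaced by two nodes holding the keys smaller, resp. larger, than $u_m$; to split the root, first create a new empty root above it); (3) join two sibling nodes $u,v$ holding at most $B-2$ keys in total that are separated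 by a unique key $p_j$ of their parent $p$ ($p_j$ is moved down, $u$, $p_j$, $v$ become one node; if $p$ becomes empty it is removed); (4) rotate the edge between the current node $u$ and its parent $p(u)$: letting $P=\{p_1<\dots<p_m\}$ be the union of keys of $u$ and $p(u)$, the keys of $u$ form a contiguous interval $[p_\ell,p_r]$ of $P$, and the rotation replaces it by any other contiguous interval $[p_{\ell'},p_{r'}]$, redistributing keys (and subtrees) accordingly, as long as both nodes still hold at most $B-1$ keys. Nodes may store $O(B\log N)$ extra bits. The cost of an algorithm on $X$ is the total number of unit-cost operations; $\mathrm{OPT}$ in a model is the minimum cost over all offline algorithms in that model. For $B=2$ the B-tree model coincides with the BST model. *)

theory Defs
  imports Complex_Main "HOL-Library.Tree"
begin

text \<open>
  In both models a configuration is a pair of a search tree and a pointer, the pointer being the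
  path from the root to the current node.  A model is given by its unit-cost transition relation
  between configurations and by the set of keys stored in the current node.  Extra bits stored in
  the nodes play no role for offline algorithms, which are arbitrary sequences of transitions.
\<close>

type_synonym ('t, 'd) config = "'t \<times> 'd list"

text \<open>
  One search: the pointer starts at the root (cost 1); after \<open>i\<close> operations the current
  node contains \<open>x\<close>, and \<open>j\<close> further operations may follow.
\<close>

definition serves1 ::
  "(('t, 'd) config \<Rightarrow> ('t, 'd) config \<Rightarrow> bool) \<Rightarrow> (('t, 'd) config \<Rightarrow> nat set) \<Rightarrow>
    nat \<Rightarrow> 't \<Rightarrow> 't \<Rightarrow> nat \<Rightarrow> bool" where
  "serves1 step node_keys x t t' c \<longleftrightarrow>
     (\<exists>i j s q. (step ^^ i) (t, []) s \<and> x \<in> node_keys s \<and> (step ^^ j) s (t', q) \<and>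
        c = 1 + i + j)"

fun serves ::
  "(('t, 'd) config \<Rightarrow> ('t, 'd) config \<Rightarrow> bool) \<Rightarrow> (('t, 'd) config \<Rightarrow> nat set) \<Rightarrow>
    nat list \<Rightarrow> 't \<Rightarrow> 't \<Rightarrow> nat \<Rightarrow> bool" where
  "serves step node_keys [] t t' c \<longleftrightarrow> t' = t \<and> c = 0"
| "serves step node_keys (x # xs) t t' c \<longleftrightarrow>
     (\<exists>t'' c1 c2. serves1 step node_keys x t t'' c1 \<and> serves step node_keys xs t'' t' c2 \<and>
        c = c1 + c2)"


section \<open>The BST model\<close>

datatype dir = L | R

fun bst_sub :: "nat tree \<Rightarrow> dir list \<Rightarrow> nat tree" where
  "bst_sub t [] = t"
| "bst_sub (Node l k r) (L # p) = bst_sub l p"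
| "bst_sub (Node l k r) (R # p) = bst_sub r p"
| "bst_sub Leaf (d # p) = Leaf"

fun bst_put :: "nat tree \<Rightarrow> dir list \<Rightarrow> nat tree \<Rightarrow> nat tree" where
  "bst_put t [] s = s"
| "bst_put (Node l k r) (L # p) s = Node (bst_put l p s) k r"
| "bst_put (Node l k r) (R # p) s = Node l k (bst_put r p s)"
| "bst_put Leaf (d # p) s = Leaf"

fun bst_node_keys :: "(nat tree, dir) config \<Rightarrow> nat set" where
  "bst_node_keys (t, p) = (case bst_sub t p of Leaf \<Rightarrow> {} | Node l k r \<Rightarrow> {k})"

inductive bst_step :: "(nat tree, dir) config \<Rightarrow> (nat tree, dir) config \<Rightarrow> bool" where
  left: "bst_sub t p = Node l k r \<Longrightarrow> l \<noteq> Leaf \<Longrightarrow> bst_step (t, p) (t, p @ [L])"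
| right: "bst_sub t p = Node l k r \<Longrightarrow> r \<noteq> Leaf \<Longrightarrow> bst_step (t, p) (t, p @ [R])"
| parent: "bst_step (t, p @ [d]) (t, p)"
| rotate_left_child: "bst_sub t p = Node (Node a x b) y c \<Longrightarrow>
    bst_step (t, p @ [L]) (bst_put t p (Node a x (Node b y c)), p)"
| rotate_right_child: "bst_sub t p = Node a x (Node b y c) \<Longrightarrow>
    bst_step (t, p @ [R]) (bst_put t p (Node (Node a x b) y c), p)"

text \<open>The initial tree is part of the offline algorithm.\<close>

definition bst_costs :: "nat \<Rightarrow> nat list \<Rightarrow> nat set" where
  "bst_costs N X = {c. \<exists>t t'. bst t \<and> set_tree t = {1..N} \<and> serves bst_step bst_node_keys X t t' c}"

definition opt_bst :: "nat \<Rightarrow> nat list \<Rightarrow> nat" where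
  "opt_bst N X = Inf (bst_costs N X)"


section \<open>The B-tree model\<close>

datatype btree = Null | BNode "nat list" "btree list"

fun btree_keys :: "btree \<Rightarrow> nat set" where
  "btree_keys Null = {}"
| "btree_keys (BNode ks ts) = set ks \<union> (\<Union>t\<in>set ts. btree_keys t)"

text \<open>Nodes are nonempty; indices start from 0, so child \<open>i\<close> lies between the keys
  \<open>i - 1\<close> and \<open>i\<close>.\<close>

fun is_btree :: "nat \<Rightarrow> btree \<Rightarrow> bool" where
  "is_btree B Null \<longleftrightarrow> True"
| "is_btree B (BNode ks ts) \<longleftrightarrow>
     ks \<noteq> [] \<and> length ks \<le> B - 1 \<and> length ts = length ks + 1 \<and> sorted_wrt (<) ks \<and>
     (\<forall>i < length ts. \<forall>x \<in> btree_keys (ts ! i).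
        (0 < i \<longrightarrow> ks ! (i - 1) < x) \<and> (i < length ks \<longrightarrow> x < ks ! i)) \<and>
     (\<forall>t \<in> set ts. is_btree B t)"

fun btree_sub :: "btree \<Rightarrow> nat list \<Rightarrow> btree" where
  "btree_sub t [] = t"
| "btree_sub (BNode ks ts) (i # p) = (if i < length ts then btree_sub (ts ! i) p else Null)"
| "btree_sub Null (i # p) = Null"

fun btree_put :: "btree \<Rightarrow> nat list \<Rightarrow> btree \<Rightarrow> btree" where
  "btree_put t [] s = s"
| "btree_put (BNode ks ts) (i # p) s =
     (if i < length ts then BNode ks (ts[i := btree_put (ts ! i) p s]) else BNode ks ts)"
| "btree_put Null (i # p) s = Null"

fun btree_node_keys :: "(btree, nat) config \<Rightarrow> nat set" where
  "btree_node_keys (t, p) = (case btree_sub t p of Null \<Rightarrow> {} | BNode ks ts \<Rightarrow> set ks)"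

text \<open>
  In the rules below \<open>p\<close> is the path of the parent, with keys \<open>ks\<close> and children \<open>ts\<close>;
  \<open>us\<close>, \<open>vs\<close> are the keys and children of the current node (for a join: \<open>us1\<close>, \<open>vs1\<close> and
  \<open>us2\<close>, \<open>vs2\<close> for the two siblings, the pointer being at either of them).
  A parent that becomes empty is removed, its only child taking its place.
  After a split or a rotation the pointer is at either of the two resulting nodes, as the
  algorithm chooses.  In a rotation, \<open>as @ bs @ cs\<close> is the increasing list of the keys of both
  nodes and \<open>bs\<close> is the new interval; \<open>ds @ es @ fs\<close> is the list of all subtrees hanging
  from the two nodes.
\<close>

inductive btree_step :: "nat \<Rightarrow> (btree, nat) config \<Rightarrow> (btree, nat) config \<Rightarrow> bool"
  for B :: nat where
  child: "btree_sub t p = BNode ks ts \<Longrightarrow> i < length ts \<Longrightarrow> ts ! i \<noteq> Null \<Longrightarrow>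
    btree_step B (t, p) (t, p @ [i])"
| parent: "btree_step B (t, p @ [i]) (t, p)"
| split:
    "btree_sub t p = BNode (ks1 @ ks2) (ts1 @ BNode (us1 @ k # us2) (vs1 @ vs2) # ts2) \<Longrightarrow>
     length ts1 = length ks1 \<Longrightarrow> length vs1 = length us1 + 1 \<Longrightarrow> us1 \<noteq> [] \<Longrightarrow> us2 \<noteq> [] \<Longrightarrow>
     length (ks1 @ ks2) < B - 1 \<Longrightarrow> j \<in> {length ts1, length ts1 + 1} \<Longrightarrow>
     btree_step B (t, p @ [length ts1])
       (btree_put t p (BNode (ks1 @ k # ks2) (ts1 @ BNode us1 vs1 # BNode us2 vs2 # ts2)),
        p @ [j])"
| split_root:
    "length vs1 = length us1 + 1 \<Longrightarrow> us1 \<noteq> [] \<Longrightarrow> us2 \<noteq> [] \<Longrightarrow> j \<in> {0, 1} \<Longrightarrow>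
     btree_step B (BNode (us1 @ k # us2) (vs1 @ vs2), [])
       (BNode [k] [BNode us1 vs1, BNode us2 vs2], [j])"
| join:
    "btree_sub t p = BNode (ks1 @ k # ks2) (ts1 @ BNode us1 vs1 # BNode us2 vs2 # ts2) \<Longrightarrow>
     length ts1 = length ks1 \<Longrightarrow> ks1 @ ks2 \<noteq> [] \<Longrightarrow> length us1 + length us2 \<le> B - 2 \<Longrightarrow>
     j \<in> {length ts1, length ts1 + 1} \<Longrightarrow>
     btree_step B (t, p @ [j])
       (btree_put t p (BNode (ks1 @ ks2) (ts1 @ BNode (us1 @ k # us2) (vs1 @ vs2) # ts2)),
        p @ [length ts1])"
| join_remove:
    "btree_sub t p = BNode [k] [BNode us1 vs1, BNode us2 vs2] \<Longrightarrow>
     length us1 + length us2 \<le> B - 2 \<Longrightarrow> j \<in> {0, 1} \<Longrightarrow>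
     btree_step B (t, p @ [j]) (btree_put t p (BNode (us1 @ k # us2) (vs1 @ vs2)), p)"
| rotate:
    "btree_sub t p = BNode (ks1 @ ks2) (ts1 @ BNode us vs # ts2) \<Longrightarrow>
     length ts1 = length ks1 \<Longrightarrow>
     ks1 @ us @ ks2 = as @ bs @ cs \<Longrightarrow> ts1 @ vs @ ts2 = ds @ es @ fs \<Longrightarrow>
     length ds = length as \<Longrightarrow> length es = length bs + 1 \<Longrightarrow>
     bs \<noteq> [] \<Longrightarrow> bs \<noteq> us \<Longrightarrow> as @ cs \<noteq> [] \<Longrightarrow>
     length bs \<le> B - 1 \<Longrightarrow> length (as @ cs) \<le> B - 1 \<Longrightarrow> q \<in> {p @ [length ds], p} \<Longrightarrow>
     btree_step B (t, p @ [length ts1])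
       (btree_put t p (BNode (as @ cs) (ds @ BNode bs es # fs)), q)"
| rotate_remove:
    "btree_sub t p = BNode (ks1 @ ks2) (ts1 @ BNode us vs # ts2) \<Longrightarrow>
     length ts1 = length ks1 \<Longrightarrow> length (ks1 @ us @ ks2) \<le> B - 1 \<Longrightarrow>
     btree_step B (t, p @ [length ts1])
       (btree_put t p (BNode (ks1 @ us @ ks2) (ts1 @ vs @ ts2)), p)"

definition btree_costs :: "nat \<Rightarrow> nat \<Rightarrow> nat list \<Rightarrow> nat set" where
  "btree_costs B N X =
     {c. \<exists>t t'. is_btree B t \<and> btree_keys t = {1..N} \<and>
           serves (btree_step B) btree_node_keys X t t' c}"

definition opt_btree :: "nat \<Rightarrow> nat \<Rightarrow> nat list \<Rightarrow> nat" where
  "opt_btree B N X = Inf (btree_costs B N X)"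


section \<open>The optima are attained\<close>

lemma serves_static:
  assumes "\<And>x. x \<in> set X \<Longrightarrow> \<exists>i q. (step ^^ i) (t, []) (t, q) \<and> x \<in> node_keys (t, q)"
  shows "\<exists>c. serves step node_keys X t t c"
  using assms
proof (induction X)
  case (Cons x X)
  then obtain c where c: "serves step node_keys X t t c" by auto
  from Cons.prems[of x] obtain i q where iq: "(step ^^ i) (t, []) (t, q)" "x \<in> node_keys (t, q)"
    by auto
  have "serves1 step node_keys x t t (1 + i + 0)"
    unfolding serves1_def using iq by (metis relpowp_0_I)
  with c show ?case by fastforce
qed auto

lemma bst_reach:
  assumes "bst_sub t p = s" "x \<in> set_tree s"
  shows "\<exists>i q. (bst_step ^^ i) (t, p) (t, q) \<and> x \<in> bst_node_keys (t, q)"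
  using assms
proof (induction s arbitrary: p)
  case (Node l k r)
  have sub: "bst_sub t (p @ q) = bst_sub (bst_sub t p) q" for t :: "nat tree" and p q
    by (induction t p rule: bst_sub.induct) (cases q; auto)+
  consider "x = k" | "x \<in> set_tree l" | "x \<in> set_tree r" using Node.prems by auto
  then show ?case
  proof cases
    case 1
    then show ?thesis using Node.prems by (intro exI[of _ 0] exI[of _ p]) auto
  next
    case 2
    then have "bst_step (t, p) (t, p @ [L])" using Node.prems by (intro bst_step.left) auto
    moreover obtain i q where "(bst_step ^^ i) (t, p @ [L]) (t, q)" "x \<in> bst_node_keys (t, q)"
      using Node.IH(1)[of "p @ [L]"] 2 Node.prems sub by auto
    ultimately show ?thesis by (metis relpowp_Suc_I2)
  next
    case 3
    then have "bst_step (t, p) (t, p @ [R])" using Node.prems by (intro bst_step.right) auto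
    moreover obtain i q where "(bst_step ^^ i) (t, p @ [R]) (t, q)" "x \<in> bst_node_keys (t, q)"
      using Node.IH(2)[of "p @ [R]"] 3 Node.prems sub by auto
    ultimately show ?thesis by (metis relpowp_Suc_I2)
  qed
qed simp

lemma btree_reach:
  assumes "btree_sub t p = s" "x \<in> btree_keys s"
  shows "\<exists>i q. (btree_step B ^^ i) (t, p) (t, q) \<and> x \<in> btree_node_keys (t, q)"
  using assms
proof (induction s arbitrary: p)
  case (BNode ks ts)
  have sub: "btree_sub t (p @ q) = btree_sub (btree_sub t p) q" for t p q
    by (induction t p rule: btree_sub.induct) (cases q; auto)+
  show ?case
  proof (cases "x \<in> set ks")
    case True
    then show ?thesis using BNode.prems by (intro exI[of _ 0] exI[of _ p]) auto
  next
    case False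
    then obtain j where j: "j < length ts" "x \<in> btree_keys (ts ! j)"
      using BNode.prems by (auto simp: in_set_conv_nth)
    then have "btree_step B (t, p) (t, p @ [j])"
      using BNode.prems by (intro btree_step.child) auto
    moreover obtain i q where "(btree_step B ^^ i) (t, p @ [j]) (t, q)" "x \<in> btree_node_keys (t, q)"
      using BNode.IH[of "ts ! j" "p @ [j]"] j BNode.prems sub by auto
    ultimately show ?thesis by (metis relpowp_Suc_I2)
  qed
qed simp

lemma opt_bst_attained:
  assumes "set X \<subseteq> {1..N}"
  shows "opt_bst N X \<in> bst_costs N X"
proof -
  have "\<exists>t. bst t \<and> set_tree t = {1..N}"
  proof (induction N)
    case (Suc N)
    then obtain t where "bst t" "set_tree t = {1..N}" by blast
    then show ?case by (intro exI[of _ "Node t (Suc N) Leaf"]) auto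
  qed (auto intro: exI[of _ Leaf])
  then obtain t where t: "bst t" "set_tree t = {1..N}" by blast
  have "\<exists>c. serves bst_step bst_node_keys X t t c"
    by (rule serves_static, rule bst_reach) (use t assms in auto)
  with t have "bst_costs N X \<noteq> {}" by (auto simp: bst_costs_def)
  then show ?thesis unfolding opt_bst_def by (rule Inf_nat_def1)
qed

lemma opt_btree_attained:
  assumes "B \<ge> 2" "set X \<subseteq> {1..N}"
  shows "opt_btree B N X \<in> btree_costs B N X"
proof -
  have "\<exists>t. is_btree B t \<and> btree_keys t = {1..N}"
  proof (induction N)
    case (Suc N)
    then obtain t where "is_btree B t" "btree_keys t = {1..N}" by blast
    then show ?case
      using assms by (intro exI[of _ "BNode [Suc N] [t, Null]"]) (auto simp: less_Suc_eq)
  qed (auto intro: exI[of _ Null])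
  then obtain t where t: "is_btree B t" "btree_keys t = {1..N}" by blast
  have "\<exists>c. serves (btree_step B) btree_node_keys X t t c"
    by (rule serves_static, rule btree_reach) (use t assms in auto)
  with t have "btree_costs B N X \<noteq> {}" by (auto simp: btree_costs_def)
  then show ?thesis unfolding opt_btree_def by (rule Inf_nat_def1)
qed

end

theory Submission
  imports Defs
begin

text \<open>
  Represent every B-tree node by an AVL tree on its keys, of height \<open>O(log B)\<close>, with the
  representations of its children hanging below it.  AVL trees can be split at a key and joined by
  \<open>O(log B)\<close> rotations and pointer moves.  Hence a contiguous interval of the keys of a node can
  be turned into a child, and a child can be absorbed into its parent, at cost \<open>O(log B)\<close>, and
  every B-tree operation is a composition of at most three such transformations and pointer moves
  across AVL trees.
\<close>

section \<open>Transforming a BST locally\<close>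

text \<open>A BST does not record where one B-tree node ends and the next begins; that boundary
  exists only in how the tree is read. Restructuring therefore means rotating until a chosen key
  interval fills one whole subtree, and then reading that subtree either as a child or as part of
  its parent. This is why the AVL trees carry arbitrary trees in their gaps instead of empty leaves.
  The delicate point is the cost of a split: it performs up to h joins, so charging O(h) for each
  would only give O(log^2 B) per operation. Joins have to be charged by the difference of the two
  heights. Nothing is amortized over B-tree operations: even an overfull intermediate node has fewer
  than 4B keys, so each single operation costs O(log B). \<open>bst_costs\<close> asks for search
  order of the initial tree, so order is established there and is not carried through
  \<open>rep\<close>.\<close>

definition bsteps :: "nat \<Rightarrow> (nat tree, dir) config \<Rightarrow> (nat tree, dir) config \<Rightarrow> bool" where
  "bsteps c x y \<longleftrightarrow> (\<exists>n\<le>c. (bst_step ^^ n) x y)"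

lemma bsteps_refl: "bsteps c x x"
  unfolding bsteps_def by (intro exI[of _ 0]) auto

lemma bsteps_step: "bst_step x y \<Longrightarrow> 1 \<le> c \<Longrightarrow> bsteps c x y"
  unfolding bsteps_def by (intro exI[of _ 1]) (auto simp: relpowp_1)

lemma bsteps_trans: "bsteps a x y \<Longrightarrow> bsteps b y z \<Longrightarrow> a + b \<le> c \<Longrightarrow> bsteps c x z"
  unfolding bsteps_def by (meson add_mono order_trans relpowp_trans)

lemma bsteps_mono: "bsteps a x y \<Longrightarrow> a \<le> b \<Longrightarrow> bsteps b x y"
  unfolding bsteps_def by (meson order_trans)

lemma bsteps_map:
  assumes "\<And>x y. bst_step x y \<Longrightarrow> bst_step (f x) (f y)" "bsteps c x y"
  shows "bsteps c (f x) (f y)"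
proof -
  have "(bst_step ^^ n) (f x) (f y)" if "(bst_step ^^ n) x y" for n y
    using that by (induction n arbitrary: y) (auto intro: assms(1))
  with assms(2) show ?thesis unfolding bsteps_def by blast
qed

text \<open>Guards against \<open>bst_put\<close> at a path that runs off the tree, which changes
  nothing, so that reading back would not return the inserted tree. The path may still end at a
  \<open>Leaf\<close>.\<close>

fun valid_path :: "nat tree \<Rightarrow> dir list \<Rightarrow> bool" where
  "valid_path t [] \<longleftrightarrow> True"
| "valid_path (Node l k r) (L # p) \<longleftrightarrow> valid_path l p"
| "valid_path (Node l k r) (R # p) \<longleftrightarrow> valid_path r p"
| "valid_path Leaf (d # p) \<longleftrightarrow> False"

lemma bst_sub_append: "bst_sub t (p @ q) = bst_sub (bst_sub t p) q"
  by (induction t p rule: bst_sub.induct) (cases q; auto)+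

lemma bst_put_sub: "bst_put t p (bst_sub t p) = t"
  by (induction t p rule: bst_sub.induct) auto

lemma bst_put_append: "bst_put t (p @ q) s = bst_put t p (bst_put (bst_sub t p) q s)"
  by (induction t p rule: bst_sub.induct) auto

lemma valid_path_append: "valid_path t (p @ q) \<longleftrightarrow> valid_path t p \<and> valid_path (bst_sub t p) q"
  by (induction t p rule: valid_path.induct) auto

lemma valid_path_put: "valid_path t p \<Longrightarrow> valid_path (bst_put t p s) p"
  by (induction t p rule: valid_path.induct) auto

lemma bst_sub_put: "valid_path t p \<Longrightarrow> bst_sub (bst_put t p s) p = s"
  by (induction t p rule: valid_path.induct) auto

lemma bst_put_put: "bst_put (bst_put t p s) p s' = bst_put t p s'"
  by (induction t p s rule: bst_put.induct) auto

lemma bst_step_left_subtree: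
  "bst_step (s, q) (s', q') \<Longrightarrow> bst_step (Node s k r, L # q) (Node s' k r, L # q')"
proof (induction "(s, q)" "(s', q')" rule: bst_step.induct)
  case left
  then show ?case using bst_step.left[of "Node s k r" "L # q"] by auto
next
  case right
  then show ?case using bst_step.right[of "Node s k r" "L # q"] by auto
next
  case (parent d)
  then show ?case using bst_step.parent[of _ "L # q'"] by auto
next
  case rotate_left_child
  then show ?case using bst_step.rotate_left_child[of "Node s k r" "L # q'"] by auto
next
  case rotate_right_child
  then show ?case using bst_step.rotate_right_child[of "Node s k r" "L # q'"] by auto
qed

lemma bst_step_right_subtree:
  "bst_step (s, q) (s', q') \<Longrightarrow> bst_step (Node l k s, R # q) (Node l k s', R # q')"
proof (induction "(s, q)" "(s', q')" rule: bst_step.induct)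
  case left
  then show ?case using bst_step.left[of "Node l k s" "R # q"] by auto
next
  case right
  then show ?case using bst_step.right[of "Node l k s" "R # q"] by auto
next
  case (parent d)
  then show ?case using bst_step.parent[of _ "R # q'"] by auto
next
  case rotate_left_child
  then show ?case using bst_step.rotate_left_child[of "Node l k s" "R # q'"] by auto
next
  case rotate_right_child
  then show ?case using bst_step.rotate_right_child[of "Node l k s" "R # q'"] by auto
qed

lemma bsteps_left_subtree:
  "bsteps c (s, q) (s', q') \<Longrightarrow> bsteps c (Node s k r, L # q) (Node s' k r, L # q')"
  using bsteps_map[of "\<lambda>(s, q). (Node s k r, L # q)" c "(s, q)" "(s', q')"]
  by (auto intro: bst_step_left_subtree)

lemma bsteps_right_subtree:
  "bsteps c (s, q) (s', q') \<Longrightarrow> bsteps c (Node l k s, R # q) (Node l k s', R # q')"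
  using bsteps_map[of "\<lambda>(s, q). (Node l k s, R # q)" c "(s, q)" "(s', q')"]
  by (auto intro: bst_step_right_subtree)

lemma bsteps_context:
  "valid_path t p \<Longrightarrow> bsteps c (bst_sub t p, q) (s', q') \<Longrightarrow>
    bsteps c (t, p @ q) (bst_put t p s', p @ q')"
  by (induction t p rule: valid_path.induct)
    (auto intro: bsteps_left_subtree bsteps_right_subtree)

lemma bsteps_up: "bsteps (length q) (t, p @ q) (t, p)"
proof (induction q rule: rev_induct)
  case (snoc d q)
  have "bst_step (t, (p @ q) @ [d]) (t, p @ q)" by (rule bst_step.parent)
  with snoc show ?case by (auto intro: bsteps_trans[OF bsteps_step])
qed (simp add: bsteps_refl)

text \<open>The model only moves to nonempty children; a nonempty endpoint forces all nodes on the
  way to be nonempty.\<close>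

lemma bsteps_down: "bst_sub t q \<noteq> Leaf \<Longrightarrow> bsteps (length q) (t, []) (t, q)"
proof (induction q arbitrary: t)
  case (Cons d q)
  then obtain l k r where t: "t = Node l k r" by (cases t) auto
  show ?case
  proof (cases d)
    case L
    then have "l \<noteq> Leaf" using Cons.prems t by (cases q) auto
    then have "bst_step (t, []) (t, [L])" using t bst_step.left[of t "[]"] by auto
    moreover have "bsteps (length q) (t, [L]) (t, [L] @ q)"
      using bsteps_left_subtree[OF Cons.IH[of l]] Cons.prems L t by auto
    ultimately show ?thesis using L by (auto intro: bsteps_trans[OF bsteps_step])
  next
    case R
    then have "r \<noteq> Leaf" using Cons.prems t by (cases q) auto
    then have "bst_step (t, []) (t, [R])" using t bst_step.right[of t "[]"] by auto
    moreover have "bsteps (length q) (t, [R]) (t, [R] @ q)"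
      using bsteps_right_subtree[OF Cons.IH[of r]] Cons.prems R t by auto
    ultimately show ?thesis using R by (auto intro: bsteps_trans[OF bsteps_step])
  qed
qed (simp add: bsteps_refl)

text \<open>Starting and ending with the pointer at the root makes transformations compose and lets
  them act inside a child for two extra moves.\<close>

definition reach :: "nat \<Rightarrow> nat tree \<Rightarrow> nat tree \<Rightarrow> bool" where
  "reach c s t \<longleftrightarrow> bsteps c (s, []) (t, [])"

lemma reach_refl: "reach c t t"
  by (simp add: reach_def bsteps_refl)

lemma reach_trans: "reach a s t \<Longrightarrow> reach b t u \<Longrightarrow> a + b \<le> c \<Longrightarrow> reach c s u"
  unfolding reach_def by (rule bsteps_trans)

lemma reach_mono: "reach a s t \<Longrightarrow> a \<le> b \<Longrightarrow> reach b s t"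
  unfolding reach_def by (rule bsteps_mono)

lemma reach_rotate_right: "reach 2 (Node (Node a x b) y c) (Node a x (Node b y c))"
proof -
  let ?t = "Node (Node a x b) y c"
  have "bst_step (?t, []) (?t, [] @ [L])" by (rule bst_step.left) auto
  moreover have "bst_step (?t, [] @ [L]) (bst_put ?t [] (Node a x (Node b y c)), [])"
    by (rule bst_step.rotate_left_child) auto
  ultimately show ?thesis unfolding reach_def
    by (intro bsteps_trans[OF bsteps_step bsteps_step]) auto
qed

lemma reach_rotate_left: "reach 2 (Node a x (Node b y c)) (Node (Node a x b) y c)"
proof -
  let ?t = "Node a x (Node b y c)"
  have "bst_step (?t, []) (?t, [] @ [R])" by (rule bst_step.right) auto
  moreover have "bst_step (?t, [] @ [R]) (bst_put ?t [] (Node (Node a x b) y c), [])"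
    by (rule bst_step.rotate_right_child) auto
  ultimately show ?thesis unfolding reach_def
    by (intro bsteps_trans[OF bsteps_step bsteps_step]) auto
qed

text \<open>The pointer cannot enter an empty subtree, so the subtree rules below treat that case
  separately: there is nothing to transform in it.\<close>

lemma reach_Leaf: "reach c Leaf t \<Longrightarrow> t = Leaf"
proof -
  have "\<not> bst_step (Leaf, []) y" for y by (auto elim: bst_step.cases)
  then have "(bst_step ^^ n) (Leaf, []) y \<Longrightarrow> y = (Leaf, [])" for n y
    by (metis relpowp_E2)
  then show "reach c Leaf t \<Longrightarrow> t = Leaf" by (auto simp: reach_def bsteps_def)
qed

lemma reach_left_subtree:
  assumes "reach c l l'"
  shows "reach (c + 2) (Node l k r) (Node l' k r)"
proof (cases "l = Leaf")
  case True
  then show ?thesis using assms reach_Leaf reach_refl by blast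
next
  case False
  have "bst_step (Node l k r, []) (Node l k r, [] @ [L])"
    using False by (intro bst_step.left) auto
  then have 1: "bsteps 1 (Node l k r, []) (Node l k r, [L])" by (simp add: bsteps_step)
  have 2: "bsteps c (Node l k r, [L]) (Node l' k r, [L])"
    using assms by (auto simp: reach_def intro: bsteps_left_subtree)
  have "bst_step (Node l' k r, [] @ [L]) (Node l' k r, [])"
    by (rule bst_step.parent)
  then have 3: "bsteps 1 (Node l' k r, [L]) (Node l' k r, [])" by (simp add: bsteps_step)
  show ?thesis unfolding reach_def
    by (rule bsteps_trans[OF bsteps_trans[OF 1 2 order_refl] 3]) simp
qed

lemma reach_right_subtree:
  assumes "reach c r r'"
  shows "reach (c + 2) (Node l k r) (Node l k r')"
proof (cases "r = Leaf")
  case True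
  then show ?thesis using assms reach_Leaf reach_refl by blast
next
  case False
  have "bst_step (Node l k r, []) (Node l k r, [] @ [R])"
    using False by (intro bst_step.right) auto
  then have 1: "bsteps 1 (Node l k r, []) (Node l k r, [R])" by (simp add: bsteps_step)
  have 2: "bsteps c (Node l k r, [R]) (Node l k r', [R])"
    using assms by (auto simp: reach_def intro: bsteps_right_subtree)
  have "bst_step (Node l k r', [] @ [R]) (Node l k r', [])"
    by (rule bst_step.parent)
  then have 3: "bsteps 1 (Node l k r', [R]) (Node l k r', [])" by (simp add: bsteps_step)
  show ?thesis unfolding reach_def
    by (rule bsteps_trans[OF bsteps_trans[OF 1 2 order_refl] 3]) simp
qed

section \<open>Left-right symmetry of BST operations\<close>

fun flip :: "dir \<Rightarrow> dir" where
  "flip L = R"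
| "flip R = L"

lemma bst_sub_mirror: "bst_sub (mirror t) (map flip p) = mirror (bst_sub t p)"
  by (induction t p rule: bst_sub.induct) auto

lemma bst_put_mirror: "bst_put (mirror t) (map flip p) (mirror s) = mirror (bst_put t p s)"
  by (induction t p s rule: bst_put.induct) auto

lemma bst_step_mirror:
  "bst_step (s, q) (s', q') \<Longrightarrow> bst_step (mirror s, map flip q) (mirror s', map flip q')"
proof (induction "(s, q)" "(s', q')" rule: bst_step.induct)
  case left
  then show ?case using bst_step.right[of "mirror s" "map flip q"] by (auto simp: bst_sub_mirror)
next
  case right
  then show ?case using bst_step.left[of "mirror s" "map flip q"] by (auto simp: bst_sub_mirror)
next
  case parent
  then show ?case using bst_step.parent by auto
next
  case (rotate_left_child a x b y c)
  then show ?case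
    using bst_step.rotate_right_child[of "mirror s" "map flip q'" "mirror c" y "mirror b" x "mirror a"]
    by (auto simp: bst_sub_mirror simp flip: bst_put_mirror)
next
  case (rotate_right_child a x b y c)
  then show ?case
    using bst_step.rotate_left_child[of "mirror s" "map flip q'" "mirror c" y "mirror b" x "mirror a"]
    by (auto simp: bst_sub_mirror simp flip: bst_put_mirror)
qed

lemma reach_mirror: "reach c s t \<Longrightarrow> reach c (mirror s) (mirror t)"
  using bsteps_map[of "\<lambda>(s, q). (mirror s, map flip q)" c "(s, [])" "(t, [])"]
  by (auto simp: reach_def intro: bst_step_mirror)


section \<open>AVL trees with hanging subtrees\<close>

text \<open>The BST \<open>t\<close> has an AVL-balanced top part of height \<open>h\<close> with keys \<open>ks\<close>; the BSTs \<open>ts\<close> hang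
  below that part and may be arbitrary.\<close>

inductive avl :: "nat list \<Rightarrow> nat tree list \<Rightarrow> nat \<Rightarrow> nat tree \<Rightarrow> bool" where
  hang: "avl [] [t] 0 t"
| node: "avl ks1 ts1 h1 l \<Longrightarrow> avl ks2 ts2 h2 r \<Longrightarrow> h1 \<le> h2 + 1 \<Longrightarrow> h2 \<le> h1 + 1 \<Longrightarrow>
    avl (ks1 @ k # ks2) (ts1 @ ts2) (1 + max h1 h2) (Node l k r)"

lemma avl_length: "avl ks ts h t \<Longrightarrow> length ts = length ks + 1"
  by (induction rule: avl.induct) auto

lemma avl_Nil: "avl [] ts h t \<longleftrightarrow> ts = [t] \<and> h = 0"
  by (auto elim: avl.cases intro: avl.hang)

lemma avl_not_Leaf: "avl ks ts h t \<Longrightarrow> ks \<noteq> [] \<Longrightarrow> t \<noteq> Leaf"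
  by (auto elim: avl.cases)

text \<open>The number of gaps, keys plus one, is additive over the two subtrees, say a + b. If both
  subtrees have height at least m, then 2^m is at most a^2, b^2 and hence a*b, so (a + b)^2 is at
  least 4 * 2^m, which pays for two more levels. This is weaker than the Fibonacci bound but enough
  for O(log B).\<close>

lemma avl_height: "avl ks ts h t \<Longrightarrow> 2 ^ h \<le> (length ks + 1)\<^sup>2"
proof (induction rule: avl.induct)
  case (node ks1 ts1 h1 l ks2 ts2 h2 r k)
  let ?a = "length ks1 + 1" and ?b = "length ks2 + 1"
  show ?case
  proof (cases "h1 = 0 \<and> h2 = 0")
    case False
    define m where "m = max h1 h2 - 1"
    have "m \<le> h1" "m \<le> h2" and m: "1 + max h1 h2 = m + 2"
      using False node.hyps by (auto simp: m_def)
    then have "(2::nat) ^ m \<le> 2 ^ h1" "(2::nat) ^ m \<le> 2 ^ h2"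
      by (auto intro: power_increasing)
    then have a: "2 ^ m \<le> ?a\<^sup>2" and b: "2 ^ m \<le> ?b\<^sup>2" using node.IH by linarith+
    have "2 ^ m \<le> ?a * ?b"
    proof (cases "?a \<le> ?b")
      case True
      then have "?a * ?a \<le> ?a * ?b" by (intro mult_left_mono) auto
      then show ?thesis using a unfolding power2_eq_square by linarith
    next
      case False
      then have "?b * ?b \<le> ?a * ?b" by (intro mult_right_mono) auto
      then show ?thesis using b unfolding power2_eq_square by linarith
    qed
    then have "4 * 2 ^ m \<le> (?a + ?b)\<^sup>2" using a b by (simp only: power2_sum)
    then show ?thesis unfolding m by (simp add: power_add)
  qed auto
qed simp

lemma avl_mirror: "avl ks ts h t \<Longrightarrow> avl (rev ks) (map mirror (rev ts)) h (mirror t)"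
proof (induction rule: avl.induct)
  case (node ks1 ts1 h1 l ks2 ts2 h2 r k)
  then show ?case using avl.node[OF node.IH(2,1), of k] by (simp add: max.commute)
qed (simp add: avl.hang)

section \<open>Rebalancing, joining and splitting\<close>

lemma avl_NodeE:
  assumes "avl ks ts h t" "0 < h"
  obtains ks1 ts1 h1 l ks2 ts2 h2 r k where "avl ks1 ts1 h1 l" "avl ks2 ts2 h2 r"
    "h1 \<le> h2 + 1" "h2 \<le> h1 + 1" "ks = ks1 @ k # ks2" "ts = ts1 @ ts2" "h = 1 + max h1 h2"
    "t = Node l k r"
  using assms by (cases rule: avl.cases) auto

text \<open>A single left rotation works unless the inner grandchild is strictly taller, which takes
  a double rotation. Equal grandchildren are allowed, and then the height becomes n + 3. The budget
  6 is that of the double rotation: 2 at the root, and 2 + 2 to rotate inside the right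
  child.\<close>

lemma avl_rebalance:
  assumes "avl ks1 ts1 n l" "avl ks2 ts2 (n + 2) r"
  shows "\<exists>t h. avl (ks1 @ k # ks2) (ts1 @ ts2) h t \<and> reach 6 (Node l k r) t \<and> n + 2 \<le> h \<and> h \<le> n + 3"
proof -
  from assms(2) obtain xs us hb b ys vs hd d c where r: "avl xs us hb b" "avl ys vs hd d"
    "hb \<le> hd + 1" "hd \<le> hb + 1" "ks2 = xs @ c # ys" "ts2 = us @ vs" "n + 2 = 1 + max hb hd"
    "r = Node b c d" by (rule avl_NodeE) auto
  show ?thesis
  proof (cases "hb \<le> hd")
    case True
    with r have hd: "hd = n + 1" "n \<le> hb" "hb \<le> n + 1" by auto
    have "avl (ks1 @ k # xs) (ts1 @ us) (1 + max n hb) (Node l k b)"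
      by (rule avl.node) (use assms r hd in auto)
    then have "avl ((ks1 @ k # xs) @ c # ys) ((ts1 @ us) @ vs) (1 + max (1 + max n hb) hd)
        (Node (Node l k b) c d)"
      by (rule avl.node) (use r hd in auto)
    moreover have "reach 6 (Node l k r) (Node (Node l k b) c d)"
      unfolding r by (rule reach_mono[OF reach_rotate_left]) simp
    moreover have "n + 2 \<le> 1 + max (1 + max n hb) hd" "1 + max (1 + max n hb) hd \<le> n + 3"
      using hd by auto
    ultimately show ?thesis unfolding r(5,6) append_assoc append_Cons by blast
  next
    case False
    with r have hb: "hb = n + 1" "hd = n" by auto
    from r(1) obtain zs ws he e zs' ws' hg g f where b: "avl zs ws he e" "avl zs' ws' hg g"
      "he \<le> hg + 1" "hg \<le> he + 1" "xs = zs @ f # zs'" "us = ws @ ws'" "hb = 1 + max he hg"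
      "b = Node e f g" by (rule avl_NodeE) (use hb in auto)
    have "avl (ks1 @ k # zs) (ts1 @ ws) (1 + max n he) (Node l k e)"
      by (rule avl.node) (use assms b hb in auto)
    moreover have "avl (zs' @ c # ys) (ws' @ vs) (1 + max hg hd) (Node g c d)"
      by (rule avl.node) (use r b hb in auto)
    ultimately have "avl ((ks1 @ k # zs) @ f # (zs' @ c # ys)) ((ts1 @ ws) @ (ws' @ vs))
        (1 + max (1 + max n he) (1 + max hg hd)) (Node (Node l k e) f (Node g c d))"
      by (rule avl.node) (use b hb in auto)
    moreover have "reach 6 (Node l k r) (Node (Node l k e) f (Node g c d))"
      unfolding r b
      by (rule reach_trans[OF reach_right_subtree[OF reach_rotate_right] reach_rotate_left]) auto
    moreover have "n + 2 \<le> 1 + max (1 + max n he) (1 + max hg hd)"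
      "1 + max (1 + max n he) (1 + max hg hd) \<le> n + 3" using b hb by auto
    ultimately show ?thesis unfolding r(5,6) b(5,6) append_assoc append_Cons by blast
  qed
qed

text \<open>Rotating right at the root pushes \<open>k\<close> and the lower tree \<open>r\<close>
  down the right spine of \<open>l\<close> until the heights fit; imbalances are repaired on the way
  back. Each level costs 10: rotation 2, entering and leaving the child 2, rebalancing at most 6.
  Since the result is at most one higher than the taller input, a repair never faces a difference
  above 2.\<close>

lemma avl_join_left:
  assumes "avl ks1 ts1 h1 l" "avl ks2 ts2 h2 r" "h2 \<le> h1 + 1"
  shows "\<exists>t h. avl (ks1 @ k # ks2) (ts1 @ ts2) h t \<and> reach (10 * (h1 - h2)) (Node l k r) t \<and>
    max h1 h2 \<le> h \<and> h \<le> 1 + max h1 h2"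
  using assms(1,3)
proof (induction rule: avl.induct)
  case (hang t)
  then have "avl ([] @ k # ks2) ([t] @ ts2) (1 + max 0 h2) (Node t k r)"
    using assms(2) by (intro avl.node avl.hang) auto
  then show ?case using reach_refl by fastforce
next
  case (node xs us ha a ys vs hb b c)
  let ?h1 = "1 + max ha hb"
  show ?case
  proof (cases "?h1 \<le> h2 + 1")
    case True
    have "avl (xs @ c # ys) (us @ vs) ?h1 (Node a c b)" by (rule avl.node) fact+
    then have "avl ((xs @ c # ys) @ k # ks2) ((us @ vs) @ ts2) (1 + max ?h1 h2) (Node (Node a c b) k r)"
      by (rule avl.node) (use node.prems assms(2) True in auto)
    then show ?thesis using reach_refl by fastforce
  next
    case False
    \<comment> \<open>The right subtree is at most one lower than its sibling, hence still no lower
      than \<open>r\<close>; so truncated subtraction loses nothing in the cost.\<close>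
    then have h2: "h2 \<le> hb" using node.hyps by auto
    then obtain t h where t: "avl (ys @ k # ks2) (vs @ ts2) h t"
      "reach (10 * (hb - h2)) (Node b k r) t" "hb \<le> h" "h \<le> 1 + hb"
      using node.IH(2) by (auto simp: max_absorb1)
    have r1: "reach (10 * (hb - h2) + 4) (Node (Node a c b) k r) (Node a c t)"
      by (rule reach_trans[OF reach_rotate_right reach_right_subtree[OF t(2)]]) auto
    have cost: "10 * (hb - h2) + 10 \<le> 10 * (?h1 - h2)" using h2 by (auto simp: max_def)
    show ?thesis
    proof (cases "h \<le> ha + 1")
      case True
      have "avl (xs @ c # (ys @ k # ks2)) (us @ (vs @ ts2)) (1 + max ha h) (Node a c t)"
        by (rule avl.node) (use node t True in auto)
      moreover have "max ?h1 h2 \<le> 1 + max ha h" "1 + max ha h \<le> 1 + max ?h1 h2"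
        using t h2 True by auto
      ultimately show ?thesis using reach_mono[OF r1] cost
        by (intro exI[of _ "Node a c t"] exI[of _ "1 + max ha h"]) auto
    next
      case False
      then have h: "h = ha + 2" "hb = ha + 1" using t node.hyps by auto
      with avl_rebalance[OF node.hyps(1) t(1)[unfolded h], of c] obtain t' h' where
        t': "avl (xs @ c # (ys @ k # ks2)) (us @ (vs @ ts2)) h' t'" "reach 6 (Node a c t) t'"
        "ha + 2 \<le> h'" "h' \<le> ha + 3" by auto
      have "reach (10 * (?h1 - h2)) (Node (Node a c b) k r) t'"
        by (rule reach_trans[OF r1 t'(2)]) (use cost in auto)
      moreover have "max ?h1 h2 \<le> h'" "h' \<le> 1 + max ?h1 h2" using t' h h2 by auto
      ultimately show ?thesis using t'(1) by auto
    qed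
  qed
qed

lemma avl_join:
  assumes "avl ks1 ts1 h1 l" "avl ks2 ts2 h2 r"
  shows "\<exists>t h. avl (ks1 @ k # ks2) (ts1 @ ts2) h t \<and>
    reach (10 * (max h1 h2 - min h1 h2)) (Node l k r) t \<and> max h1 h2 \<le> h \<and> h \<le> 1 + max h1 h2"
proof (cases "h2 \<le> h1")
  case True
  then have "max h1 h2 = h1" "min h1 h2 = h2" "h2 \<le> h1 + 1" by auto
  then show ?thesis using avl_join_left[OF assms, of k] by presburger
next
  case False
  obtain t h where t: "avl (rev ks2 @ k # rev ks1) (map mirror (rev ts2) @ map mirror (rev ts1)) h t"
    "reach (10 * (h2 - h1)) (Node (mirror r) k (mirror l)) t" "max h2 h1 \<le> h" "h \<le> 1 + max h2 h1"
    using avl_join_left[OF avl_mirror[OF assms(2)] avl_mirror[OF assms(1)], of k] False by auto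
  have mm: "mirror \<circ> mirror = (id :: nat tree \<Rightarrow> nat tree)" by auto
  have "avl (ks1 @ k # ks2) (ts1 @ ts2) h (mirror t)"
    using avl_mirror[OF t(1)] by (simp add: rev_map mm)
  moreover have "reach (10 * (h2 - h1)) (Node l k r) (mirror t)"
    using reach_mirror[OF t(2)] by simp
  moreover have "max h1 h2 = h2" "min h1 h2 = h1" "max h2 h1 = h2" using False by auto
  ultimately show ?thesis using t(3,4) by metis
qed


text \<open>The cost of each join on the way up is paid for by the increase of \<open>h1 + h2\<close>, so the total
  telescopes to \<open>O(h)\<close>.\<close>

lemma avl_split:
  assumes "avl ks ts h t" "ks = ks1 @ k # ks2" "ts = ts1 @ ts2" "length ts1 = length ks1 + 1"
  shows "\<exists>l r h1 h2. avl ks1 ts1 h1 l \<and> avl ks2 ts2 h2 r \<and> h1 \<le> h \<and> h2 \<le> h \<and>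
    reach (10 * (h1 + h2) + 16 * h) t (Node l k r)"
  using assms
proof (induction arbitrary: ks1 ks2 ts1 ts2 rule: avl.induct)
  case (node xs us ha a ys vs hb b c)
  note len = avl_length[OF node.hyps(1)] avl_length[OF node.hyps(2)]
  consider (eq) "xs = ks1" "c = k" "ys = ks2"
    | (left) zs where "xs = ks1 @ k # zs" "ks2 = zs @ c # ys"
    | (right) zs where "ks1 = xs @ c # zs" "ys = zs @ k # ks2"
    using node.prems(1) by (auto simp: append_eq_append_conv2 append_eq_Cons_conv Cons_eq_append_conv)
  then show ?case
  proof cases
    case eq
    then have "us = ts1" "vs = ts2" using node.prems len by auto
    then show ?thesis using node.hyps eq
      by (intro exI[of _ a] exI[of _ b] exI[of _ ha] exI[of _ hb]) (auto simp: reach_refl)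
  next
    case left
    obtain ws where ws: "us = ts1 @ ws" "ts2 = ws @ vs"
      using node.prems(2,3) len left by (auto simp: append_eq_append_conv2)
    obtain l r h1 h2 where lr: "avl ks1 ts1 h1 l" "avl zs ws h2 r" "h1 \<le> ha" "h2 \<le> ha"
      "reach (10 * (h1 + h2) + 16 * ha) a (Node l k r)"
      using node.IH(1)[OF left(1) ws(1) node.prems(3)] by blast
    obtain t h where t: "avl (zs @ c # ys) (ws @ vs) h t"
      "reach (10 * (max h2 hb - min h2 hb)) (Node r c b) t" "max h2 hb \<le> h" "h \<le> 1 + max h2 hb"
      using avl_join[OF lr(2) node.hyps(2)] by blast
    have "reach (10 * (h1 + h2) + 16 * ha + 4) (Node a c b) (Node l k (Node r c b))"
      by (rule reach_trans[OF reach_left_subtree[OF lr(5)] reach_rotate_right]) auto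
    \<comment> \<open>Each level has 16 to spend: 6 for moves and the rotation, and 10 for the case
      that \<open>r\<close> is higher than \<open>b\<close>, which can be by one only because
      \<open>h2\<close> is at most \<open>ha\<close>. Otherwise the join is paid by the growth from
      \<open>h2\<close> to \<open>h\<close>.\<close>
    moreover have "10 * (h1 + h2) + 16 * ha + 4 + (10 * (max h2 hb - min h2 hb) + 2)
        \<le> 10 * (h1 + h) + 16 * (1 + max ha hb)"
      using t lr node.hyps by (auto simp: max_def min_def)
    ultimately have "reach (10 * (h1 + h) + 16 * (1 + max ha hb)) (Node a c b) (Node l k t)"
      using reach_right_subtree[OF t(2)] reach_trans by blast
    moreover have "h1 \<le> 1 + max ha hb" "h \<le> 1 + max ha hb" using lr t by auto
    ultimately show ?thesis using lr(1) t(1) left(2) ws(2) by blast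
  next
    case right
    obtain ws where ws: "ts1 = us @ ws" "vs = ws @ ts2" "length ws = length zs + 1"
      using node.prems(2,3) len right by (auto simp: append_eq_append_conv2)
    obtain l r h1 h2 where lr: "avl zs ws h1 l" "avl ks2 ts2 h2 r" "h1 \<le> hb" "h2 \<le> hb"
      "reach (10 * (h1 + h2) + 16 * hb) b (Node l k r)"
      using node.IH(2)[OF right(2) ws(2) ws(3)] by blast
    obtain t h where t: "avl (xs @ c # zs) (us @ ws) h t"
      "reach (10 * (max ha h1 - min ha h1)) (Node a c l) t" "max ha h1 \<le> h" "h \<le> 1 + max ha h1"
      using avl_join[OF node.hyps(1) lr(1)] by blast
    have "reach (10 * (h1 + h2) + 16 * hb + 4) (Node a c b) (Node (Node a c l) k r)"
      by (rule reach_trans[OF reach_right_subtree[OF lr(5)] reach_rotate_left]) auto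
    moreover have "10 * (h1 + h2) + 16 * hb + 4 + (10 * (max ha h1 - min ha h1) + 2)
        \<le> 10 * (h + h2) + 16 * (1 + max ha hb)"
      using t lr node.hyps by (auto simp: max_def min_def)
    ultimately have "reach (10 * (h + h2) + 16 * (1 + max ha hb)) (Node a c b) (Node t k r)"
      using reach_left_subtree[OF t(2)] reach_trans by blast
    moreover have "h2 \<le> 1 + max ha hb" "h \<le> 1 + max ha hb" using lr t by auto
    ultimately show ?thesis using lr(2) t(1) right(1) ws(1) by blast
  qed
qed simp

text \<open>The first key of \<open>cs\<close> is the pivot: split there, reread the left tree, and
  join around the same key again. Without such a key the whole tree already is \<open>u\<close>.
  Fixing \<open>u\<close> before quantifying over \<open>ms'\<close> expresses that only the reading
  of \<open>u\<close> changes. The cost is 36h for the split and 10(h + \<open>hu'\<close>) for the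
  join.\<close>

lemma avl_replace_prefix:
  assumes "avl (ms @ cs) (es @ fs) h s" "length es = length ms + 1"
  shows "\<exists>u hu. avl ms es hu u \<and> (\<forall>ms' es' hu'. avl ms' es' hu' u \<longrightarrow>
    (\<exists>s' h'. avl (ms' @ cs) (es' @ fs) h' s' \<and> h' \<le> h + hu' + 1 \<and> reach (46 * h + 10 * hu') s s'))"
proof (cases cs)
  case Nil
  then have "fs = []" using assms avl_length[OF assms(1)] by auto
  then show ?thesis using Nil assms reach_refl
    by (intro exI[of _ s] exI[of _ h]) fastforce
next
  case (Cons c cs')
  obtain u r h1 h2 where ur: "avl ms es h1 u" "avl cs' fs h2 r" "h1 \<le> h" "h2 \<le> h"
    "reach (10 * (h1 + h2) + 16 * h) s (Node u c r)"
    using avl_split[OF assms(1) _ refl assms(2)] Cons by blast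
  have "\<exists>s' h'. avl (ms' @ cs) (es' @ fs) h' s' \<and> h' \<le> h + hu' + 1 \<and> reach (46 * h + 10 * hu') s s'"
    if u': "avl ms' es' hu' u" for ms' es' hu'
  proof -
    obtain t h' where t: "avl (ms' @ cs) (es' @ fs) h' t"
      "reach (10 * (max hu' h2 - min hu' h2)) (Node u c r) t" "h' \<le> 1 + max hu' h2"
      using avl_join[OF u' ur(2), of c] Cons by blast
    have "reach (46 * h + 10 * hu') s t"
      by (rule reach_trans[OF ur(5) t(2)]) (use ur in auto)
    moreover have "h' \<le> h + hu' + 1" using t ur by auto
    ultimately show ?thesis using t(1) by blast
  qed
  then show ?thesis using ur(1) by blast
qed

text \<open>Since the tree \<open>u\<close> holding the interval \<open>ms\<close> can be reinterpreted as any other AVL tree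
  \<open>ms'\<close>, this covers both hanging off an interval (\<open>ms' = []\<close>) and absorbing a hanging
  subtree (\<open>ms = []\<close>).\<close>

lemma avl_replace:
  assumes "avl (as @ ms @ cs) (ds @ es @ fs) h s" "length ds = length as" "length es = length ms + 1"
  shows "\<exists>u hu. avl ms es hu u \<and> (\<forall>ms' es' hu'. avl ms' es' hu' u \<longrightarrow>
    (\<exists>s' h'. avl (as @ ms' @ cs) (ds @ es' @ fs) h' s' \<and> reach (100 * (h + hu' + 1)) s s'))"
proof (cases as rule: rev_cases)
  case Nil
  then have ds: "ds = []" using assms(2) by simp
  have mono: "reach (100 * (h + hu' + 1)) s s'" if "reach (46 * h + 10 * hu') s s'" for hu' s'
    using that by (rule reach_mono) simp
  have "avl (ms @ cs) (es @ fs) h s" using assms(1) Nil ds by simp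
  from avl_replace_prefix[OF this assms(3)] show ?thesis
    unfolding Nil ds append_Nil by (blast intro: mono)
next
  case (snoc as' a)
  obtain l r h1 h2 where lr: "avl as' ds h1 l" "avl (ms @ cs) (es @ fs) h2 r" "h1 \<le> h" "h2 \<le> h"
    "reach (10 * (h1 + h2) + 16 * h) s (Node l a r)"
    using avl_split[OF assms(1) _ refl, of as' a "ms @ cs"] snoc assms(2) by auto
  obtain u hu where u: "avl ms es hu u" "\<And>ms' es' hu'. avl ms' es' hu' u \<Longrightarrow>
    \<exists>s' h'. avl (ms' @ cs) (es' @ fs) h' s' \<and> h' \<le> h2 + hu' + 1 \<and> reach (46 * h2 + 10 * hu') r s'"
    using avl_replace_prefix[OF lr(2) assms(3)] by blast
  have "\<exists>s' h'. avl (as @ ms' @ cs) (ds @ es' @ fs) h' s' \<and> reach (100 * (h + hu' + 1)) s s'"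
    if u': "avl ms' es' hu' u" for ms' es' hu'
  proof -
    obtain r' h' where r': "avl (ms' @ cs) (es' @ fs) h' r'" "h' \<le> h2 + hu' + 1"
      "reach (46 * h2 + 10 * hu') r r'"
      using u(2)[OF u'] by blast
    obtain t h'' where t: "avl (as' @ a # ms' @ cs) (ds @ es' @ fs) h'' t"
      "reach (10 * (max h1 h' - min h1 h')) (Node l a r') t"
      using avl_join[OF lr(1) r'(1), of a] by blast
    have "reach (10 * (h1 + h2) + 16 * h + (46 * h2 + 10 * hu' + 2)) s (Node l a r')"
      by (rule reach_trans[OF lr(5) reach_right_subtree[OF r'(3)]]) simp
    then have "reach (100 * (h + hu' + 1)) s t"
      \<comment> \<open>At most 36h for the outer split, 46h + 10\<open>hu'\<close> + 2 inside the
        right part, and 10(h + \<open>hu'\<close> + 1) for the last join; 100 is a round bound on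
        the sum.\<close>
      by (rule reach_trans[OF _ t(2)]) (use lr r' in auto)
    then show ?thesis using t(1) snoc by auto
  qed
  then show ?thesis using u(1) by blast
qed

text \<open>The last conjunct lets a child be exchanged without disturbing the balance above it, so
  that a change deep in the tree never propagates upwards.\<close>

lemma avl_hanging_path:
  assumes "avl ks ts h t" "i < length ts"
  shows "\<exists>q. valid_path t q \<and> length q \<le> h \<and> bst_sub t q = ts ! i \<and>
    (\<forall>u. avl ks (ts[i := u]) h (bst_put t q u))"
  using assms
proof (induction arbitrary: i rule: avl.induct)
  case (hang t)
  then show ?case by (intro exI[of _ "[]"]) (auto intro: avl.hang)
next
  case (node ks1 ts1 h1 l ks2 ts2 h2 r k)
  show ?case
  proof (cases "i < length ts1")
    case True
    then obtain q where "valid_path l q" "length q \<le> h1" "bst_sub l q = ts1 ! i"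
      "\<forall>u. avl ks1 (ts1[i := u]) h1 (bst_put l q u)" using node.IH(1) by blast
    then show ?thesis using True node.hyps
      by (intro exI[of _ "L # q"])
        (auto simp: nth_append list_update_append simp del: One_nat_def intro!: avl.node[simplified])
  next
    case False
    then obtain q where "valid_path r q" "length q \<le> h2" "bst_sub r q = ts2 ! (i - length ts1)"
      "\<forall>u. avl ks2 (ts2[i - length ts1 := u]) h2 (bst_put r q u)"
      using node.IH(2)[of "i - length ts1"] node.prems by fastforce
    then show ?thesis using False node.hyps
      by (intro exI[of _ "R # q"])
        (auto simp: nth_append list_update_append simp del: One_nat_def intro!: avl.node[simplified])
  qed
qed

lemma avl_key_path:
  "avl ks ts h t \<Longrightarrow> x \<in> set ks \<Longrightarrow> \<exists>q l r. length q \<le> h \<and> bst_sub t q = Node l x r"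
proof (induction rule: avl.induct)
  case (node ks1 ts1 h1 l ks2 ts2 h2 r k)
  then consider "x = k" | "x \<in> set ks1" | "x \<in> set ks2" by auto
  then show ?case
  proof cases
    case 1
    then show ?thesis by (intro exI[of _ "[]"]) auto
  next
    case 2
    then obtain q l' r' where "length q \<le> h1" "bst_sub l q = Node l' x r'" using node.IH by blast
    then show ?thesis by (intro exI[of _ "L # q"]) auto
  next
    case 3
    then obtain q l' r' where "length q \<le> h2" "bst_sub r q = Node l' x r'" using node.IH by blast
    then show ?thesis by (intro exI[of _ "R # q"]) auto
  qed
qed simp

section \<open>Existence, key sets and search order, for the initial tree\<close>

lemma avl_exists: "length ts = length ks + 1 \<Longrightarrow> \<exists>h t. avl ks ts h t"
proof (induction ks arbitrary: ts)
  case Nil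
  then show ?case by (cases ts) (auto intro: avl.hang)
next
  case (Cons k ks)
  then obtain u ts' where ts: "ts = u # ts'" "length ts' = length ks + 1" by (cases ts) auto
  then obtain h t where "avl ks ts' h t" using Cons.IH by blast
  from avl_join[OF avl.hang[of u] this, of k] show ?case using ts by auto
qed

lemma avl_set_tree: "avl ks ts h t \<Longrightarrow> set_tree t = set ks \<union> (\<Union>u \<in> set ts. set_tree u)"
  by (induction rule: avl.induct) auto

lemma avl_bst:
  assumes "avl ks ts h t" "sorted_wrt (<) ks" "\<And>u. u \<in> set ts \<Longrightarrow> bst u"
    "\<And>i x. i < length ts \<Longrightarrow> x \<in> set_tree (ts ! i) \<Longrightarrow>
      (0 < i \<longrightarrow> ks ! (i - 1) < x) \<and> (i < length ks \<longrightarrow> x < ks ! i)"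
  shows "bst t"
  using assms
proof (induction rule: avl.induct)
  case (node ks1 ts1 h1 l ks2 ts2 h2 r k)
  note len = avl_length[OF node.hyps(1)] avl_length[OF node.hyps(2)]
  \<comment> \<open>The last gap of the left part has no key of \<open>ks1\<close> to its right; its
    upper bound is the root key \<open>k\<close>. Dually, \<open>b2\<close> bounds the first gap of
    the right part from below by \<open>k\<close>.\<close>
  have b1: "(0 < i \<longrightarrow> ks1 ! (i - 1) < x) \<and> (if i < length ks1 then x < ks1 ! i else x < k)"
    if "i < length ts1" "x \<in> set_tree (ts1 ! i)" for i x
    using node.prems(3)[of i x] that len by (auto simp: nth_append split: if_splits)
  have b2: "(0 < i \<longrightarrow> ks2 ! (i - 1) < x) \<and> (i = 0 \<longrightarrow> k < x) \<and> (i < length ks2 \<longrightarrow> x < ks2 ! i)"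
    if "i < length ts2" "x \<in> set_tree (ts2 ! i)" for i x
    using node.prems(3)[of "length ts1 + i" x] that len by (auto simp: nth_append split: if_splits)
  have lt: "\<And>y. y \<in> set ks1 \<Longrightarrow> y < k" "\<And>y. y \<in> set ks2 \<Longrightarrow> k < y"
    using node.prems(1) by (auto simp: sorted_wrt_append)
  have "bst l" using node.IH(1) node.prems(1,2) b1 by (auto simp: sorted_wrt_append split: if_splits)
  moreover have "bst r"
    using node.IH(2) node.prems(1,2) b2 by (auto simp: sorted_wrt_append split: if_splits)
  moreover have "x < k" if xl: "x \<in> set_tree l" for x
  proof -
    consider "x \<in> set ks1" | i where "i < length ts1" "x \<in> set_tree (ts1 ! i)"
      using xl avl_set_tree[OF node.hyps(1)] by (fastforce simp: in_set_conv_nth[of _ ts1])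
    then show ?thesis
    proof cases
      case (2 i)
      then show ?thesis using b1[OF 2] lt(1)[OF nth_mem, of i] by (auto split: if_splits)
    qed (use lt in auto)
  qed
  moreover have "k < x" if xr: "x \<in> set_tree r" for x
  proof -
    consider "x \<in> set ks2" | i where "i < length ts2" "x \<in> set_tree (ts2 ! i)"
      using xr avl_set_tree[OF node.hyps(2)] by (fastforce simp: in_set_conv_nth[of _ ts2])
    then show ?thesis
    proof cases
      case (2 i)
      show ?thesis
      proof (cases "i = 0")
        case False
        then have "k < ks2 ! (i - 1)" using 2 len by (intro lt nth_mem) auto
        then show ?thesis using b2[OF 2] False by auto
      qed (use b2[OF 2] in simp)
    qed (use lt in auto)
  qed
  ultimately show ?case by simp
qed simp


section \<open>Representing B-trees by BSTs\<close>

text \<open>With fewer than 4B keys the height is at most 2 log(4B) = 4 + 2 log B, which is at most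
  6 log B because log B is at least 1. The floor keeps costs natural numbers. The factor 4 covers a
  parent merged with two children, at most 3(B - 1) keys.\<close>

definition height_bound :: "nat \<Rightarrow> nat" where
  "height_bound B = nat \<lfloor>6 * log 2 (real B)\<rfloor>"

lemma height_bound_pos: "2 \<le> B \<Longrightarrow> 1 \<le> height_bound B"
proof -
  assume "2 \<le> B"
  then have "1 \<le> log 2 (real B)" by (simp add: le_log_iff)
  then show ?thesis unfolding height_bound_def by (intro le_nat_floor) simp
qed

lemma avl_height_bound:
  assumes "avl ks ts h t" "2 \<le> B" "length ks < 4 * B"
  shows "h \<le> height_bound B"
proof -
  have "2 ^ h \<le> (length ks + 1)\<^sup>2" by (rule avl_height[OF assms(1)])
  also have "\<dots> \<le> (4 * B)\<^sup>2" using assms(3) by (intro power_mono) auto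
  finally have "real (2 ^ h) \<le> real ((4 * B)\<^sup>2)" by (simp only: of_nat_le_iff)
  then have "log 2 (2 ^ h) \<le> log 2 ((4 * real B)\<^sup>2)"
    using assms(2) by (subst log_le_cancel_iff) auto
  also have "\<dots> = 2 * log 2 (2 ^ 2 * real B)" using assms(2) by (subst log_nat_power) auto
  also have "\<dots> = 2 * (log 2 (2 ^ 2) + log 2 (real B))" using assms(2) by (subst log_mult) auto
  also have "\<dots> = 2 * (2 + log 2 (real B))" by (subst log_pow_cancel) auto
  also have "\<dots> \<le> 6 * log 2 (real B)"
  proof -
    have "1 \<le> log 2 (real B)" using assms(2) by (simp add: le_log_iff)
    then show ?thesis by simp
  qed
  finally show ?thesis unfolding height_bound_def by (intro le_nat_floor) (simp add: log_nat_power)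
qed

inductive rep :: "nat \<Rightarrow> btree \<Rightarrow> nat tree \<Rightarrow> bool" for B where
  Null: "rep B Null Leaf"
| BNode: "ks \<noteq> [] \<Longrightarrow> length ks \<le> B - 1 \<Longrightarrow> list_all2 (rep B) ts ss \<Longrightarrow> avl ks ss h t \<Longrightarrow>
    rep B (BNode ks ts) t"

text \<open>Like \<^const>\<open>rep\<close> for a node, but the node may be overfull or empty, as happens between the
  phases of an operation.\<close>

definition node_rep :: "nat \<Rightarrow> nat list \<Rightarrow> btree list \<Rightarrow> nat tree \<Rightarrow> bool" where
  "node_rep B ks ts t \<longleftrightarrow> (\<exists>ss h. list_all2 (rep B) ts ss \<and> avl ks ss h t)"

lemma rep_BNode:
  "rep B (BNode ks ts) t \<longleftrightarrow> ks \<noteq> [] \<and> length ks \<le> B - 1 \<and> node_rep B ks ts t"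
  by (auto simp: node_rep_def elim!: rep.cases intro: rep.BNode)

lemma node_rep_length: "node_rep B ks ts t \<Longrightarrow> length ts = length ks + 1"
  by (metis avl_length list_all2_lengthD node_rep_def)

lemma rep_not_Leaf: "rep B T t \<Longrightarrow> T \<noteq> Null \<Longrightarrow> t \<noteq> Leaf"
  by (auto elim!: rep.cases dest: avl_not_Leaf)

lemma node_rep_child:
  assumes "node_rep B ks ts t" "BNode us vs \<in> set ts"
  shows "us \<noteq> [] \<and> length us \<le> B - 1 \<and> length vs = length us + 1"
proof -
  obtain s where "rep B (BNode us vs) s"
    using assms by (auto simp: node_rep_def list_all2_conv_all_nth in_set_conv_nth)
  then show ?thesis by (auto simp: rep_BNode dest: node_rep_length)
qed

lemma node_rep_absorb:
  assumes "node_rep B (ks1 @ ks2) (ts1 @ BNode us vs # ts2) s" "length ts1 = length ks1"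
    "length (ks1 @ ks2) < 4 * B" "2 \<le> B"
  shows "\<exists>s'. node_rep B (ks1 @ us @ ks2) (ts1 @ vs @ ts2) s' \<and> reach (300 * height_bound B) s s'"
proof -
  obtain ss1 u ss2 h where ss: "list_all2 (rep B) ts1 ss1" "rep B (BNode us vs) u"
    "list_all2 (rep B) ts2 ss2" "avl (ks1 @ [] @ ks2) (ss1 @ [u] @ ss2) h s"
    using assms(1) by (auto simp: node_rep_def list_all2_append1 list_all2_Cons1)
  obtain ws h' where ws: "list_all2 (rep B) vs ws" "avl us ws h' u" and us: "length us \<le> B - 1"
    using ss(2) by (auto simp: rep_BNode node_rep_def)
  have "length ss1 = length ks1" using ss(1) assms(2) by (auto dest: list_all2_lengthD)
  from avl_replace[OF ss(4) this] obtain u' hu where "avl [] [u] hu u'"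
    and u': "\<And>ms' es' hu'. avl ms' es' hu' u' \<Longrightarrow> \<exists>s' h'. avl (ks1 @ ms' @ ks2) (ss1 @ es' @ ss2) h' s' \<and>
      reach (100 * (h + hu' + 1)) s s'"
    by auto
  \<comment> \<open>The interval isolated is the empty one in the gap of the child, so the isolated
    tree is the child itself and can be reread as an AVL tree on \<open>us\<close>.\<close>
  then have "u' = u" by (simp add: avl_Nil)
  obtain s' h'' where
    s': "avl (ks1 @ us @ ks2) (ss1 @ ws @ ss2) h'' s'" "reach (100 * (h + h' + 1)) s s'"
    using u'[unfolded \<open>u' = u\<close>, OF ws(2)] by blast
  have "h \<le> height_bound B" using avl_height_bound[OF ss(4)] assms by simp
  moreover have "h' \<le> height_bound B" using avl_height_bound[OF ws(2)] assms us by simp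
  ultimately have "reach (300 * height_bound B) s s'"
    using height_bound_pos[OF assms(4)] by (intro reach_mono[OF s'(2)]) simp
  moreover have "node_rep B (ks1 @ us @ ks2) (ts1 @ vs @ ts2) s'"
    unfolding node_rep_def using s'(1) ss ws by (blast intro: list_all2_appendI)
  ultimately show ?thesis by blast
qed

lemma node_rep_extract:
  assumes "node_rep B (as @ bs @ cs) (ds @ es @ fs) s" "length ds = length as"
    "length es = length bs + 1" "bs \<noteq> []" "length bs \<le> B - 1"
    "length (as @ bs @ cs) < 4 * B" "2 \<le> B"
  shows "\<exists>s'. node_rep B (as @ cs) (ds @ BNode bs es # fs) s' \<and> reach (300 * height_bound B) s s'"
proof -
  obtain ss1 ws ss2 h where ss: "list_all2 (rep B) ds ss1" "list_all2 (rep B) es ws"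
    "list_all2 (rep B) fs ss2" "avl (as @ bs @ cs) (ss1 @ ws @ ss2) h s"
    using assms(1) by (auto simp: node_rep_def list_all2_append1)
  have len: "length ss1 = length as" "length ws = length bs + 1"
    using ss assms(2,3) by (auto dest: list_all2_lengthD)
  obtain u hu s' h' where u: "avl bs ws hu u" "avl (as @ [] @ cs) (ss1 @ [u] @ ss2) h' s'"
    "reach (100 * (h + 0 + 1)) s s'"
    using avl_replace[OF ss(4) len] avl.hang by blast
  have "h \<le> height_bound B" using avl_height_bound[OF ss(4)] assms by simp
  then have "reach (300 * height_bound B) s s'"
    using height_bound_pos[OF assms(7)] by (intro reach_mono[OF u(3)]) simp
  moreover have "rep B (BNode bs es) u"
    using assms(4,5) ss(2) u(1) by (auto simp: rep_BNode node_rep_def)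
  then have "list_all2 (rep B) (ds @ BNode bs es # fs) (ss1 @ u # ss2)"
    using ss by (auto intro: list_all2_appendI)
  then have "node_rep B (as @ cs) (ds @ BNode bs es # fs) s'"
    unfolding node_rep_def using u(2) by auto
  ultimately show ?thesis by blast
qed

section \<open>Structural B-tree operations on representations\<close>

lemma rep_split:
  assumes "rep B (BNode (ks1 @ ks2) (ts1 @ BNode (us1 @ k # us2) (vs1 @ vs2) # ts2)) s"
    "length ts1 = length ks1" "length vs1 = length us1 + 1" "us1 \<noteq> []" "us2 \<noteq> []"
    "length (ks1 @ ks2) < B - 1"
  shows "\<exists>s'. rep B (BNode (ks1 @ k # ks2) (ts1 @ BNode us1 vs1 # BNode us2 vs2 # ts2)) s' \<and>
    reach (900 * height_bound B) s s'"
proof -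
  have B: "2 \<le> B" using assms(6) by simp
  have s: "node_rep B (ks1 @ ks2) (ts1 @ BNode (us1 @ k # us2) (vs1 @ vs2) # ts2) s"
    using assms(1) by (simp add: rep_BNode)
  note child = node_rep_child[OF s, of "us1 @ k # us2" "vs1 @ vs2"]
  have fit: "length ks1 + (Suc (length us1 + length us2) + length ks2) < 4 * B"
    using child assms(6) by auto
  obtain s1 where s1: "node_rep B (ks1 @ (us1 @ k # us2) @ ks2) (ts1 @ (vs1 @ vs2) @ ts2) s1"
    "reach (300 * height_bound B) s s1"
    using node_rep_absorb[OF s assms(2) _ B] assms(6) by fastforce
  \<comment> \<open>After the child is absorbed, both halves are extracted again; \<open>k\<close>
    moves up simply by being left behind. Three phases of 300 give the common budget 900 used for
    all operations.\<close>
  obtain s2 where s2: "node_rep B (ks1 @ k # us2 @ ks2) (ts1 @ BNode us1 vs1 # vs2 @ ts2) s2"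
    "reach (300 * height_bound B) s1 s2"
    using node_rep_extract[of B ks1 us1 "k # us2 @ ks2" ts1 vs1 "vs2 @ ts2" s1] s1(1) assms child
      fit B by auto
  obtain s3 where s3:
    "node_rep B (ks1 @ k # ks2) (ts1 @ BNode us1 vs1 # BNode us2 vs2 # ts2) s3"
    "reach (300 * height_bound B) s2 s3"
    using node_rep_extract[of B "ks1 @ [k]" us2 ks2 "ts1 @ [BNode us1 vs1]" vs2 ts2 s2]
      s2(1) assms child fit B by auto
  have "reach (900 * height_bound B) s s3"
    by (rule reach_trans[OF reach_trans[OF s1(2) s2(2) order_refl] s3(2)]) simp
  then show ?thesis using s3(1) assms(6) by (auto simp: rep_BNode)
qed

text \<open>The root itself plays the merged node: once both halves are extracted, the remaining
  \<open>[k]\<close> is the new root.\<close>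

lemma rep_split_root:
  assumes "rep B (BNode (us1 @ k # us2) (vs1 @ vs2)) s"
    "length vs1 = length us1 + 1" "us1 \<noteq> []" "us2 \<noteq> []"
  shows "\<exists>s'. rep B (BNode [k] [BNode us1 vs1, BNode us2 vs2]) s' \<and>
    reach (900 * height_bound B) s s'"
proof -
  have s: "node_rep B (us1 @ k # us2) (vs1 @ vs2) s" "length (us1 @ k # us2) \<le> B - 1"
    using assms(1) by (simp_all add: rep_BNode)
  note len = node_rep_length[OF s(1)]
  have B: "2 \<le> B" using s(2) by simp
  have fit: "Suc (length us1 + length us2) < 4 * B" using s(2) by simp
  obtain s1 where s1: "node_rep B (k # us2) (BNode us1 vs1 # vs2) s1"
    "reach (300 * height_bound B) s s1"
    using node_rep_extract[of B "[]" us1 "k # us2" "[]" vs1 vs2 s] s assms B fit by auto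
  obtain s2 where s2: "node_rep B [k] [BNode us1 vs1, BNode us2 vs2] s2"
    "reach (300 * height_bound B) s1 s2"
    using node_rep_extract[of B "[k]" us2 "[]" "[BNode us1 vs1]" vs2 "[]" s1] s1(1) s(2) assms len
      B fit by auto
  have "reach (900 * height_bound B) s s2"
    by (rule reach_trans[OF s1(2) s2(2)]) simp
  then show ?thesis using s2(1) B by (auto simp: rep_BNode)
qed

lemma node_rep_absorb2:
  assumes "node_rep B (ks1 @ k # ks2) (ts1 @ BNode us1 vs1 # BNode us2 vs2 # ts2) s"
    "length ts1 = length ks1" "length (ks1 @ k # ks2) \<le> B - 1"
  shows "\<exists>s'. node_rep B (ks1 @ (us1 @ k # us2) @ ks2) (ts1 @ (vs1 @ vs2) @ ts2) s' \<and>
    reach (600 * height_bound B) s s'"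
proof -
  have B: "2 \<le> B" using assms(3) by simp
  note child = node_rep_child[OF assms(1), of us1 vs1]
  have fit: "Suc (length ks1 + (length us1 + length ks2)) < 4 * B" using child assms(3) by auto
  obtain s1 where s1: "node_rep B (ks1 @ us1 @ k # ks2) (ts1 @ vs1 @ BNode us2 vs2 # ts2) s1"
    "reach (300 * height_bound B) s s1"
    using node_rep_absorb[OF assms(1,2) _ B] assms(3) by fastforce
  obtain s2 where s2:
    "node_rep B (ks1 @ (us1 @ k # us2) @ ks2) (ts1 @ (vs1 @ vs2) @ ts2) s2"
    "reach (300 * height_bound B) s1 s2"
    using node_rep_absorb[of B "ks1 @ us1 @ [k]" ks2 "ts1 @ vs1" us2 vs2 ts2 s1] s1(1) assms child B
      fit by auto
  have "reach (600 * height_bound B) s s2"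
    by (rule reach_trans[OF s1(2) s2(2)]) simp
  then show ?thesis using s2(1) by blast
qed

text \<open>Both siblings are absorbed, and the interval consisting of their keys and
  \<open>k\<close> is extracted as one child.\<close>

lemma rep_join:
  assumes "rep B (BNode (ks1 @ k # ks2) (ts1 @ BNode us1 vs1 # BNode us2 vs2 # ts2)) s"
    "length ts1 = length ks1" "ks1 @ ks2 \<noteq> []" "length us1 + length us2 \<le> B - 2"
  shows "\<exists>s'. rep B (BNode (ks1 @ ks2) (ts1 @ BNode (us1 @ k # us2) (vs1 @ vs2) # ts2)) s' \<and>
    reach (900 * height_bound B) s s'"
proof -
  have s: "node_rep B (ks1 @ k # ks2) (ts1 @ BNode us1 vs1 # BNode us2 vs2 # ts2) s"
    "length (ks1 @ k # ks2) \<le> B - 1"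
    using assms(1) by (simp_all add: rep_BNode)
  have B: "2 \<le> B" using s(2) by simp
  note child = node_rep_child[OF s(1), of us1 vs1] node_rep_child[OF s(1), of us2 vs2]
  have fit: "Suc (length us1 + length us2) \<le> B - Suc 0"
    "Suc (length ks1 + (length us1 + (length us2 + length ks2))) < 4 * B"
    using assms(4) s(2) B by auto
  obtain s1 where s1: "node_rep B (ks1 @ (us1 @ k # us2) @ ks2) (ts1 @ (vs1 @ vs2) @ ts2) s1"
    "reach (600 * height_bound B) s s1"
    using node_rep_absorb2[OF s(1) assms(2) s(2)] by blast
  obtain s2 where s2: "node_rep B (ks1 @ ks2) (ts1 @ BNode (us1 @ k # us2) (vs1 @ vs2) # ts2) s2"
    "reach (300 * height_bound B) s1 s2"
    using node_rep_extract[OF s1(1) assms(2) _ _ _ _ B] assms(4) s(2) child fit by auto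
  have "reach (900 * height_bound B) s s2"
    by (rule reach_trans[OF s1(2) s2(2)]) simp
  then show ?thesis using s2(1) s(2) assms(3) by (auto simp: rep_BNode)
qed

lemma rep_join_remove:
  assumes "rep B (BNode [k] [BNode us1 vs1, BNode us2 vs2]) s" "length us1 + length us2 \<le> B - 2"
  shows "\<exists>s'. rep B (BNode (us1 @ k # us2) (vs1 @ vs2)) s' \<and> reach (900 * height_bound B) s s'"
proof -
  have s: "node_rep B [k] [BNode us1 vs1, BNode us2 vs2] s" "length [k] \<le> B - 1"
    using assms(1) by (simp_all add: rep_BNode)
  obtain s1 where s1: "node_rep B (us1 @ k # us2) (vs1 @ vs2) s1"
    "reach (600 * height_bound B) s s1"
    using node_rep_absorb2[of B "[]" k "[]" "[]" us1 vs1 us2 vs2 "[]" s] s by auto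
  then have "reach (900 * height_bound B) s s1" by (auto intro: reach_mono)
  then show ?thesis using s1(1) s(2) assms(2) by (auto simp: rep_BNode)
qed

text \<open>Absorbing the child yields the union of both key sets; extracting \<open>bs\<close>
  realizes any admissible new interval.\<close>

lemma rep_rotate:
  assumes "rep B (BNode (ks1 @ ks2) (ts1 @ BNode us vs # ts2)) s" "length ts1 = length ks1"
    "ks1 @ us @ ks2 = as @ bs @ cs" "ts1 @ vs @ ts2 = ds @ es @ fs"
    "length ds = length as" "length es = length bs + 1" "bs \<noteq> []" "as @ cs \<noteq> []"
    "length bs \<le> B - 1" "length (as @ cs) \<le> B - 1"
  shows "\<exists>s'. rep B (BNode (as @ cs) (ds @ BNode bs es # fs)) s' \<and> reach (900 * height_bound B) s s'"
proof -
  have s: "node_rep B (ks1 @ ks2) (ts1 @ BNode us vs # ts2) s" "length (ks1 @ ks2) \<le> B - 1"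
    and B: "2 \<le> B"
    using assms(1) by (auto simp: rep_BNode neq_Nil_conv)
  obtain s1 where s1: "node_rep B (as @ bs @ cs) (ds @ es @ fs) s1"
    "reach (300 * height_bound B) s s1"
    using node_rep_absorb[OF s(1) assms(2) _ B] assms(3,4) s(2) B by fastforce
  obtain s2 where s2: "node_rep B (as @ cs) (ds @ BNode bs es # fs) s2"
    "reach (300 * height_bound B) s1 s2"
    using node_rep_extract[OF s1(1) assms(5,6,7,9) _ B] assms(9,10) B by fastforce
  have "reach (900 * height_bound B) s s2"
    by (rule reach_trans[OF s1(2) s2(2)]) simp
  then show ?thesis using s2(1) assms(8,10) by (auto simp: rep_BNode)
qed

lemma rep_rotate_remove:
  assumes "rep B (BNode (ks1 @ ks2) (ts1 @ BNode us vs # ts2)) s" "length ts1 = length ks1"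
    "length (ks1 @ us @ ks2) \<le> B - 1"
  shows "\<exists>s'. rep B (BNode (ks1 @ us @ ks2) (ts1 @ vs @ ts2)) s' \<and> reach (900 * height_bound B) s s'"
proof -
  have s: "node_rep B (ks1 @ ks2) (ts1 @ BNode us vs # ts2) s" "length (ks1 @ ks2) \<le> B - 1"
    and ne: "ks1 @ ks2 \<noteq> []" and B: "2 \<le> B"
    using assms(1) by (auto simp: rep_BNode neq_Nil_conv)
  obtain s1 where s1: "node_rep B (ks1 @ us @ ks2) (ts1 @ vs @ ts2) s1"
    "reach (300 * height_bound B) s s1"
    using node_rep_absorb[OF s(1) assms(2) _ B] s(2) B by fastforce
  then have "reach (900 * height_bound B) s s1" by (auto intro: reach_mono)
  then show ?thesis using s1(1) ne assms(3) by (auto simp: rep_BNode)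
qed

text \<open>The initial BST is free, so it may be built to match the initial B-tree; later B-trees
  are tracked through \<open>rep\<close> alone.\<close>

lemma is_btree_rep:
  "is_btree B T \<Longrightarrow> \<exists>t. rep B T t \<and> set_tree t = btree_keys T \<and> bst t"
proof (induction T)
  case Null
  then show ?case by (intro exI[of _ Leaf]) (auto intro: rep.Null)
next
  case (BNode ks ts)
  then have "\<forall>T \<in> set ts. \<exists>t. rep B T t \<and> set_tree t = btree_keys T \<and> bst t" by auto
  then obtain f where f: "\<And>T. T \<in> set ts \<Longrightarrow> rep B T (f T) \<and> set_tree (f T) = btree_keys T \<and> bst (f T)"
    by metis
  obtain h t where t: "avl ks (map f ts) h t"
    using avl_exists[of "map f ts" ks] BNode.prems by auto
  have "list_all2 (rep B) ts (map f ts)" using f by (auto simp: list_all2_conv_all_nth)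
  then have "rep B (BNode ks ts) t" using BNode.prems t by (auto intro: rep.BNode)
  moreover have "set_tree t = btree_keys (BNode ks ts)" using avl_set_tree[OF t] f by auto
  moreover have "bst t"
    by (rule avl_bst[OF t]) (use BNode.prems f in auto)
  ultimately show ?case by blast
qed


section \<open>Simulating the B-tree operations\<close>

text \<open>\<open>conf B T p t q\<close>: the BST \<open>t\<close> represents \<open>T\<close>, and \<open>q\<close> leads to the root of the
  AVL tree that represents the node at \<open>p\<close>.\<close>

inductive conf :: "nat \<Rightarrow> btree \<Rightarrow> nat list \<Rightarrow> nat tree \<Rightarrow> dir list \<Rightarrow> bool" for B where
  root: "rep B T t \<Longrightarrow> conf B T [] t []"
| down: "ks \<noteq> [] \<Longrightarrow> length ks \<le> B - 1 \<Longrightarrow> list_all2 (rep B) ts ss \<Longrightarrow> avl ks ss h t \<Longrightarrow>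
    i < length ts \<Longrightarrow> valid_path t q0 \<Longrightarrow> length q0 \<le> h \<Longrightarrow> bst_sub t q0 = ss ! i \<Longrightarrow>
    (\<forall>u. avl ks (ss[i := u]) h (bst_put t q0 u)) \<Longrightarrow> conf B (ts ! i) p (ss ! i) q \<Longrightarrow>
    conf B (BNode ks ts) (i # p) t (q0 @ q)"

inductive_cases conf_NilE: "conf B T [] t q"
inductive_cases conf_ConsE: "conf B T (i # p) t q"

lemma conf_rep: "conf B T p t q \<Longrightarrow> rep B T t"
  by (induction rule: conf.induct) (auto intro: rep.BNode)

lemma conf_short_path:
  assumes "conf B T r t q" "length r \<le> 1" "2 \<le> B"
  shows "length q \<le> height_bound B"
proof (cases r)
  case Nil
  then show ?thesis using assms by (auto elim: conf_NilE)
next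
  case (Cons i r')
  with assms have "conf B T (i # []) t q" by simp
  then show ?thesis
  proof (rule conf_ConsE, goal_cases)
    case (1 ks ts ss h q0 q')
    then have "h \<le> height_bound B" using avl_height_bound assms(3) by simp
    then show ?thesis using 1 by (auto elim: conf_NilE)
  qed
qed

text \<open>Focusing on the node at \<open>p\<close>: the surrounding tree is a context into which
  any represented subtree, with the pointer anywhere in it, can be put back.\<close>

lemma conf_append:
  assumes "conf B T (p @ r) t q"
  shows "\<exists>q1 q2. q = q1 @ q2 \<and> valid_path t q1 \<and> conf B (btree_sub T p) r (bst_sub t q1) q2 \<and>
    (\<forall>S r' s q'. conf B S r' s q' \<longrightarrow> conf B (btree_put T p S) (p @ r') (bst_put t q1 s) (q1 @ q'))"
  using assms
proof (induction p arbitrary: T t q)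
  case Nil
  then show ?case by (intro exI[of _ "[]"] exI[of _ q]) auto
next
  case (Cons i p)
  then have "conf B T (i # (p @ r)) t q" by simp
  then show ?case
  proof (rule conf_ConsE, goal_cases)
    case (1 ks ts ss h q0 q')
    from Cons.IH[OF 1(12)] obtain q1 q2 where
      q: "q' = q1 @ q2" "valid_path (ss ! i) q1" "conf B (btree_sub (ts ! i) p) r (bst_sub (ss ! i) q1) q2"
      and put: "\<And>S r' s q'. conf B S r' s q' \<Longrightarrow>
        conf B (btree_put (ts ! i) p S) (p @ r') (bst_put (ss ! i) q1 s) (q1 @ q')"
      by blast
    have "conf B (btree_put T (i # p) S) ((i # p) @ r') (bst_put t (q0 @ q1) s) ((q0 @ q1) @ qs)"
      if "conf B S r' s qs" for S r' s qs
    proof -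
      let ?S = "btree_put (ts ! i) p S" and ?s = "bst_put (ss ! i) q1 s"
      have c: "conf B ?S (p @ r') ?s (q1 @ qs)" by (rule put[OF that])
      have i: "i < length ss" using 1 by (auto dest: list_all2_lengthD)
      have "list_all2 (rep B) (ts[i := ?S]) (ss[i := ?s])"
        using 1 conf_rep[OF c] by (intro list_all2_update_cong) auto
      then have "conf B (BNode ks (ts[i := ?S])) (i # (p @ r')) (bst_put t q0 ?s) (q0 @ (q1 @ qs))"
        using 1 i c by (intro conf.down[of ks B _ "ss[i := ?s]" h])
          (auto simp: valid_path_put bst_sub_put bst_put_put)
      then show ?thesis using 1 by (simp add: bst_put_append)
    qed
    moreover have "q = (q0 @ q1) @ q2" using 1 q by simp
    moreover have "valid_path t (q0 @ q1)" using 1 q by (simp add: valid_path_append)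
    moreover have "conf B (btree_sub T (i # p)) r (bst_sub t (q0 @ q1)) q2"
      using 1 q by (simp add: bst_sub_append)
    ultimately show ?thesis by blast
  qed
qed

lemma conf_descend:
  assumes "rep B S s" "r = [] \<or> (\<exists>j. r = [j] \<and> btree_sub S [j] \<noteq> Null)" "2 \<le> B"
  shows "\<exists>q. conf B S r s q \<and> bsteps (height_bound B) (s, []) (s, q)"
  using assms(2)
proof
  assume "r = []"
  then show ?thesis using assms(1) by (auto intro: conf.root bsteps_refl)
next
  assume "\<exists>j. r = [j] \<and> btree_sub S [j] \<noteq> Null"
  then obtain j where j: "r = [j]" "btree_sub S [j] \<noteq> Null" by blast
  then obtain ks ts where S: "S = BNode ks ts" "j < length ts" "ts ! j \<noteq> Null"
    by (cases S) (auto split: if_splits)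
  obtain ss h where ss: "ks \<noteq> []" "length ks \<le> B - 1" "list_all2 (rep B) ts ss" "avl ks ss h s"
    using assms(1) S by (auto simp: rep_BNode node_rep_def)
  have js: "j < length ss" "rep B (ts ! j) (ss ! j)"
    using ss S by (auto dest: list_all2_lengthD list_all2_nthD)
  obtain q where q: "valid_path s q" "length q \<le> h" "bst_sub s q = ss ! j"
    "\<forall>u. avl ks (ss[j := u]) h (bst_put s q u)"
    using avl_hanging_path[OF ss(4) js(1)] by blast
  have "conf B S r s (q @ [])"
    unfolding S j using S ss q js by (intro conf.down conf.root) auto
  then have c: "conf B S r s q" by simp
  have "bsteps (length q) (s, []) (s, q)"
    using rep_not_Leaf[OF js(2) S(3)] q by (intro bsteps_down) simp
  moreover have "length q \<le> height_bound B" using conf_short_path[OF c] j assms(3) by simp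
  ultimately show ?thesis using c by (blast intro: bsteps_mono)
qed

text \<open>Every B-tree operation is seen from the topmost node involved, with the pointer at most
  one edge below it before and after. The pointer climbs to the root of that node's AVL tree, the
  subtree is transformed, and the pointer descends; each walk crosses at most one AVL tree.\<close>

lemma simulate_local:
  assumes "conf B T (p @ r) t q" "length r \<le> 1" "2 \<le> B"
    and "\<And>s. rep B (btree_sub T p) s \<Longrightarrow> \<exists>s'. rep B S s' \<and> reach c s s'"
    and "r' = [] \<or> (\<exists>j. r' = [j] \<and> btree_sub S [j] \<noteq> Null)"
  shows "\<exists>t' q'. conf B (btree_put T p S) (p @ r') t' q' \<and>
    bsteps (c + 2 * height_bound B) (t, q) (t', q')"
proof -
  obtain q1 q2 where q: "q = q1 @ q2" "valid_path t q1" "conf B (btree_sub T p) r (bst_sub t q1) q2"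
    and put: "\<And>S r' s q'. conf B S r' s q' \<Longrightarrow> conf B (btree_put T p S) (p @ r') (bst_put t q1 s) (q1 @ q')"
    using conf_append[OF assms(1)] by blast
  obtain s where s: "rep B S s" "reach c (bst_sub t q1) s" using assms(4) conf_rep[OF q(3)] by blast
  obtain q3 where q3: "conf B S r' s q3" "bsteps (height_bound B) (s, []) (s, q3)"
    using conf_descend[OF s(1) assms(5,3)] by blast
  have "bsteps (height_bound B) (bst_sub t q1, q2) (bst_sub t q1, [])"
    using bsteps_up[of q2 _ "[]"] conf_short_path[OF q(3) assms(2,3)] by (auto intro: bsteps_mono)
  then have "bsteps (height_bound B + c) (bst_sub t q1, q2) (s, [])"
    by (rule bsteps_trans[OF _ s(2)[unfolded reach_def]]) simp
  then have "bsteps (c + 2 * height_bound B) (bst_sub t q1, q2) (s, q3)"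
    by (rule bsteps_trans[OF _ q3(2)]) simp
  then have "bsteps (c + 2 * height_bound B) (t, q) (bst_put t q1 s, q1 @ q3)"
    unfolding q(1) by (rule bsteps_context[OF q(2)])
  then show ?thesis using put[OF q3(1)] by blast
qed

lemma btree_put_sub: "btree_put T p (btree_sub T p) = T"
  by (induction T p rule: btree_sub.induct) auto

lemma simulate_step:
  assumes "btree_step B (T, p) (T', p')" "conf B T p t q" "2 \<le> B"
  shows "\<exists>t' q'. conf B T' p' t' q' \<and> bsteps (902 * height_bound B) (t, q) (t', q')"
proof -
  let ?c = "900 * height_bound B"
  have bound: "?c + 2 * height_bound B = 902 * height_bound B" by simp
  note local = simulate_local[where c = ?c and B = B and T = T and t = t and q = q, unfolded bound]
  have stay: "rep B S s \<Longrightarrow> \<exists>s'. rep B S s' \<and> reach ?c s s'" for S s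
    using reach_refl by blast
  from assms(1) show ?thesis
  proof (cases rule: btree_step.cases)
    \<comment> \<open>Pointer moves are local operations that replace the subtree by itself.\<close>
    case (child ks ts i)
    then show ?thesis
      using local[of p "[]" "btree_sub T p" "[i]"] assms(2,3) stay btree_put_sub[of T p] by simp
  next
    case (parent i)
    then show ?thesis
      using local[of p' "[i]" "btree_sub T p'" "[]"] assms(2,3) stay by (auto simp: btree_put_sub)
  next
    case (split p0 ks1 ks2 ts1 us1 k us2 vs1 vs2 ts2 j)
    show ?thesis unfolding split
      by (rule local) (use assms(2,3) split rep_split in \<open>auto simp: nth_append\<close>)
  next
    case (split_root vs1 us1 us2 j k vs2)
    then show ?thesis
      using local[of "[]" "[]" "BNode [k] [BNode us1 vs1, BNode us2 vs2]" "[j]"] assms(2,3)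
        rep_split_root by auto
  next
    case (join p0 ks1 k ks2 ts1 us1 vs1 us2 vs2 ts2 j)
    show ?thesis unfolding join
      by (rule local) (use assms(2,3) join rep_join in \<open>auto simp: nth_append\<close>)
  next
    case (join_remove k us1 vs1 us2 vs2 j)
    then show ?thesis
      using local[of p' "[j]" "BNode (us1 @ k # us2) (vs1 @ vs2)" "[]"] assms(2,3) rep_join_remove
      by auto
  next
    case (rotate p0 ks1 ks2 ts1 us vs ts2 as bs cs ds es fs)
    define r where "r = (if p' = p0 then [] else [length ds])"
    have "p' = p0 @ r" using rotate by (auto simp: r_def)
    show ?thesis unfolding rotate(2) \<open>p' = p0 @ r\<close>
      by (rule local) (use assms(2,3) rotate rep_rotate in \<open>auto simp: nth_append r_def\<close>)
  next
    case (rotate_remove ks1 ks2 ts1 us vs ts2)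
    then show ?thesis
      using local[of p' "[length ts1]" "BNode (ks1 @ us @ ks2) (ts1 @ vs @ ts2)" "[]"] assms(2,3)
        rep_rotate_remove by auto
  qed
qed

section \<open>Operation sequences and searches\<close>

lemma simulate_steps:
  assumes "(btree_step B ^^ n) (T, p) (T', p')" "conf B T p t q" "2 \<le> B"
  shows "\<exists>t' q'. conf B T' p' t' q' \<and> bsteps (n * (902 * height_bound B)) (t, q) (t', q')"
  using assms(1)
proof (induction n arbitrary: T' p')
  case 0
  then show ?case using assms(2) bsteps_refl by fastforce
next
  case (Suc n)
  then obtain T1 p1 where 1: "(btree_step B ^^ n) (T, p) (T1, p1)" "btree_step B (T1, p1) (T', p')"
    by auto
  obtain t1 q1 where t1: "conf B T1 p1 t1 q1" "bsteps (n * (902 * height_bound B)) (t, q) (t1, q1)"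
    using Suc.IH[OF 1(1)] by blast
  obtain t' q' where t': "conf B T' p' t' q'" "bsteps (902 * height_bound B) (t1, q1) (t', q')"
    using simulate_step[OF 1(2) t1(1) assms(3)] by blast
  have "bsteps (Suc n * (902 * height_bound B)) (t, q) (t', q')"
    by (rule bsteps_trans[OF t1(2) t'(2)]) simp
  then show ?case using t'(1) by blast
qed

text \<open>A B-tree pointer touches all keys of its node at once, whereas the BST pointer rests at
  the AVL root; it makes an excursion to \<open>x\<close> and returns to restore
  \<open>conf\<close>.\<close>

lemma conf_touch:
  assumes "conf B T p t q" "x \<in> btree_node_keys (T, p)" "2 \<le> B"
  shows "\<exists>q'. x \<in> bst_node_keys (t, q') \<and> bsteps (height_bound B) (t, q) (t, q') \<and>
    bsteps (height_bound B) (t, q') (t, q)"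
proof -
  obtain q1 q2 where q12: "q = q1 @ q2" "valid_path t q1" "conf B (btree_sub T p) [] (bst_sub t q1) q2"
    using conf_append[of B T p "[]" t q] assms(1) by auto
  then have q: "valid_path t q" and c: "rep B (btree_sub T p) (bst_sub t q)"
    by (auto elim: conf_NilE dest: conf_rep)
  obtain ks ts where S: "btree_sub T p = BNode ks ts" "x \<in> set ks"
    using assms(2) by (auto split: btree.splits)
  obtain ss h where h: "avl ks ss h (bst_sub t q)" "length ks \<le> B - 1"
    using c S by (auto simp: rep_BNode node_rep_def)
  obtain q' l r where q': "length q' \<le> h" "bst_sub (bst_sub t q) q' = Node l x r"
    using avl_key_path[OF h(1) S(2)] by blast
  have len: "length q' \<le> height_bound B"
    using q'(1) avl_height_bound[OF h(1) assms(3)] h(2) assms(3) by linarith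
  have "bsteps (length q') (bst_sub t q, []) (bst_sub t q, q')" using q' by (intro bsteps_down) simp
  from bsteps_context[OF q this] have "bsteps (height_bound B) (t, q) (t, q @ q')"
    using len by (auto simp: bst_put_sub intro: bsteps_mono)
  moreover have "bsteps (height_bound B) (t, q @ q') (t, q)"
    using bsteps_up len by (blast intro: bsteps_mono)
  moreover have "x \<in> bst_node_keys (t, q @ q')" using q' by (simp add: bst_sub_append)
  ultimately show ?thesis by blast
qed

lemma simulate_search:
  assumes "serves1 (btree_step B) btree_node_keys x T T' c" "rep B T t" "2 \<le> B"
  shows "\<exists>t' c'. rep B T' t' \<and> serves1 bst_step bst_node_keys x t t' c' \<and>
    c' \<le> c * (905 * height_bound B)"
proof -
  let ?H = "height_bound B"
  obtain i j S p p' where 1: "(btree_step B ^^ i) (T, []) (S, p)" "x \<in> btree_node_keys (S, p)"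
    "(btree_step B ^^ j) (S, p) (T', p')" "c = 1 + i + j"
    using assms(1) unfolding serves1_def by (metis surj_pair)
  obtain s q where s: "conf B S p s q" "bsteps (i * (902 * ?H)) (t, []) (s, q)"
    using simulate_steps[OF 1(1) conf.root[OF assms(2)] assms(3)] by blast
  obtain t' q' where t': "conf B T' p' t' q'" "bsteps (j * (902 * ?H)) (s, q) (t', q')"
    using simulate_steps[OF 1(3) s(1) assms(3)] by blast
  obtain qx where x: "x \<in> bst_node_keys (s, qx)" "bsteps ?H (s, q) (s, qx)" "bsteps ?H (s, qx) (s, q)"
    using conf_touch[OF s(1) 1(2) assms(3)] by blast
  obtain m where m: "(bst_step ^^ m) (t, []) (s, qx)" "m \<le> i * (902 * ?H) + ?H"
    using bsteps_trans[OF s(2) x(2) order_refl] unfolding bsteps_def by blast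
  obtain n where n: "(bst_step ^^ n) (s, qx) (t', q')" "n \<le> ?H + j * (902 * ?H)"
    using bsteps_trans[OF x(3) t'(2) order_refl] unfolding bsteps_def by blast
  have "serves1 bst_step bst_node_keys x t t' (1 + m + n)"
    unfolding serves1_def using m(1) n(1) x(1) by blast
  moreover have "1 + m + n \<le> 1 + (i * (902 * ?H) + ?H) + (?H + j * (902 * ?H))"
    using m(2) n(2) by linarith
  \<comment> \<open>Each operation costs 902H; the excursion (2H) and the initial unit (at most H)
    are charged to the unit cost of starting the B-tree search, whence 905.\<close>
  then have "1 + m + n \<le> c * (905 * ?H)"
    using height_bound_pos[OF assms(3)] 1(4) by (simp add: algebra_simps)
  ultimately show ?thesis using conf_rep[OF t'(1)] by blast
qed

lemma simulate_serves:
  assumes "serves (btree_step B) btree_node_keys X T T' c" "rep B T t" "2 \<le> B"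
  shows "\<exists>t' c'. serves bst_step bst_node_keys X t t' c' \<and> c' \<le> c * (905 * height_bound B)"
  using assms(1,2)
proof (induction X arbitrary: T t c)
  case Nil
  then show ?case by auto
next
  case (Cons x X)
  then obtain T1 c1 c2 where 1: "serves1 (btree_step B) btree_node_keys x T T1 c1"
    "serves (btree_step B) btree_node_keys X T1 T' c2" "c = c1 + c2" by auto
  obtain t1 d1 where t1: "rep B T1 t1" "serves1 bst_step bst_node_keys x t t1 d1"
    "d1 \<le> c1 * (905 * height_bound B)"
    using simulate_search[OF 1(1) Cons.prems(2) assms(3)] by blast
  obtain t' d2 where t': "serves bst_step bst_node_keys X t1 t' d2"
    "d2 \<le> c2 * (905 * height_bound B)"
    using Cons.IH[OF 1(2) t1(1)] by blast
  have "d1 + d2 \<le> c * (905 * height_bound B)"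
    unfolding 1(3) add_mult_distrib using t1(3) t'(2) by (rule add_mono)
  moreover have "serves bst_step bst_node_keys (x # X) t t' (d1 + d2)"
    using t1(2) t'(1) by auto
  ultimately show ?case by blast
qed

theorem theorem1:
  shows "\<exists>C::real. C > 0 \<and>
    (\<forall>(B::nat) (N::nat) (X::nat list). B \<ge> 2 \<longrightarrow> set X \<subseteq> {1..N} \<longrightarrow>
      real (opt_bst N X) \<le> C * (real (opt_btree B N X) * log 2 (real B)))"
proof (intro exI[of _ 5430] conjI allI impI)
  fix B N :: nat and X :: "nat list"
  assume B: "B \<ge> 2" and X: "set X \<subseteq> {1..N}"
  obtain T T' where T: "is_btree B T" "btree_keys T = {1..N}"
    "serves (btree_step B) btree_node_keys X T T' (opt_btree B N X)"
    using opt_btree_attained[OF B X] by (auto simp: btree_costs_def)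
  obtain t where t: "rep B T t" "set_tree t = {1..N}" "bst t"
    using is_btree_rep[OF T(1)] T(2) by auto
  obtain t' c where c: "serves bst_step bst_node_keys X t t' c"
    "c \<le> opt_btree B N X * (905 * height_bound B)"
    using simulate_serves[OF T(3) t(1) B] by blast
  have "c \<in> bst_costs N X" using c(1) t by (auto simp: bst_costs_def)
  then have "opt_bst N X \<le> c" unfolding opt_bst_def by (rule wellorder_Inf_le1)
  with c(2) have "real (opt_bst N X) \<le> real (opt_btree B N X * (905 * height_bound B))"
    by (simp only: of_nat_le_iff)
  also have "\<dots> = 905 * real (opt_btree B N X) * real (height_bound B)" by simp
  \<comment> \<open>Dropping the floor contributes the factor 6, and 905 * 6 = 5430.\<close>
  also have "\<dots> \<le> 905 * real (opt_btree B N X) * (6 * log 2 (real B))"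
    unfolding height_bound_def using B by (intro mult_left_mono of_nat_floor) auto
  finally show "real (opt_bst N X) \<le> 5430 * (real (opt_btree B N X) * log 2 (real B))"
    by (simp add: algebra_simps)
qed simp

end
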